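(* Let $V_h$ be the finite element space built from either of the two local spaces $W(T)$ defined in the context. There exists $C$ depending on $\Omega$ and on the shape regularity of $\mathcal T_h$, but independent of $h$, such that for every $v\in V_h$, \[ \|v\|_{H_h^2}\le C\left(\|\nabla_h\epsilon(v)\|_{L^2}+\|\epsilon(v)\|_{L^2}\right). \]
   Context: $\Omega\subset\mathbb R^2$ is a bounded polygon and $\mathcal T_h$ is a (conforming) shape-regular triangulation of $\Omega$ with maximum mesh size $h$. $\epsilon(v)=\frac12(\nabla v+[\nabla v]^T)$; $\nabla_h^k$ is the elementwise $k$-th gradient, $\nabla_h=\nabla_h^1$, $\|\nabla_h^kv\|_{L^2}^2=\sum_{T\in\mathcal T_h}\|\nabla^kv\|_{L^2(T)}^2$, and $\|v\|_{H_h^2}=\|v\|_{L^2}+\sum_{k=1}^2\|\nabla_h^kv\|_{L^2}$. Local spaces: for a triangle $T$ with barycentric coordinates $\lambda_1,\lambda_2,\lambda_3$ and $b=\lambda_1\lambda_2\lambda_3$, either (first element) $W(T)=[P_2(T)]^2\oplus bP_2^\ast(T)$ with $P_2^\ast(T)=\{v\in[P_2(T)]^2 : v\cdot n|_e\in P_1(e)\ \text{for all edges } e \text{ of } T\}$, or (second element) $W(T)=[P_2(T)]^2\oplus bP_3^\ast(T)$ with $P_3^\ast(T)=\{w\in[P_3(T)]^2 : \nabla\cdot w\in P_0(T),\ w\cdot n|_e\in P_1(e)\ \text{for all edges } e \text{ of } T\}$. Here $P_k$ denotes polynomials of degree at most $k$, and $n$, $t$ are unit normal and tangent vectors of the edge.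 The degrees of freedom of $W(T)$ are the values at the vertices and edge midpoints and, for each edge $e$, the moments $\int_e\partial_n(w\cdot t)\,d\tau$ and $\int_e\partial_n(w\cdot n)\tau^k\,d\tau$, $k=0,1$, where $\tau$ is arclength along $e$. The global space $V_h$ consists of all $v\in[H_0^1(\Omega)]^2$ with $v|_T\in W(T)$ for all $T\in\mathcal T_h$ whose degrees of freedom match across edges and vanish on $\partial\Omega$; i.e. in addition, for every edge $e$ of $\mathcal T_h$, $\int_e[\![\partial_n(v\cdot n)]\!]\tau^k\,d\tau=0$ for $k=0,1$ and $\int_e[\![\partial_n(v\cdot t)]\!]\,d\tau=0$, where $[\![\cdot]\!]$ is the jump across $e$ (the trace if $e\subset\partial\Omega$). *)

theory Defs
  imports "HOL-Analysis.Analysis"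
begin

subsection \<open>Gradients\<close>

definition partial_deriv :: "2 \<Rightarrow> (real^2 \<Rightarrow> 'b::real_normed_vector) \<Rightarrow> real^2 \<Rightarrow> 'b" where
  "partial_deriv j f x = frechet_derivative f (at x) (axis j 1)"

text \<open>The derivative index comes first: \<open>grad v x $ j $ i\<close> is the \<open>j\<close>-th partial derivative of
  the \<open>i\<close>-th component. The norm of \<^typ>\<open>real^2^2\<close> and \<^typ>\<open>real^2^2^2\<close> is the Frobenius norm.\<close>

definition grad :: "(real^2 \<Rightarrow> 'b::real_normed_vector) \<Rightarrow> real^2 \<Rightarrow> 'b^2" where
  "grad f x = (\<chi> j. partial_deriv j f x)"

text \<open>Pointwise derivatives: the functions of interest are piecewise polynomial and continuous, so
  these exist off the (null) edges of the triangulation and agree almost everywhere with the weak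
  derivatives.\<close>

definition strain :: "(real^2 \<Rightarrow> real^2) \<Rightarrow> real^2 \<Rightarrow> real^2^2" where
  "strain v x = (1/2) *\<^sub>R (grad v x + transpose (grad v x))"

definition divergence :: "(real^2 \<Rightarrow> real^2) \<Rightarrow> real^2 \<Rightarrow> real" where
  "divergence v x = (\<Sum>i\<in>UNIV. partial_deriv i v x $ i)"

subsection \<open>The spaces $L^2$ and $H^1_0$\<close>

definition L2_space :: "(real^2) set \<Rightarrow> (real^2 \<Rightarrow> 'b::euclidean_space) set" where
  "L2_space S = {f \<in> borel_measurable (lebesgue_on S).
     integrable (lebesgue_on S) (\<lambda>x. (norm (f x))\<^sup>2)}"

definition L2_norm :: "(real^2) set \<Rightarrow> (real^2 \<Rightarrow> 'b::euclidean_space) \<Rightarrow> real" where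
  "L2_norm S f = sqrt (LINT x|lebesgue_on S. (norm (f x))\<^sup>2)"

primrec C_k :: "nat \<Rightarrow> (real^2 \<Rightarrow> 'b::euclidean_space) \<Rightarrow> bool" where
  "C_k 0 f \<longleftrightarrow> continuous_on UNIV f"
| "C_k (Suc k) f \<longleftrightarrow> (\<forall>x. f differentiable (at x)) \<and> (\<forall>j. C_k k (partial_deriv j f))"

definition test_functions :: "(real^2) set \<Rightarrow> (real^2 \<Rightarrow> 'b::euclidean_space) set" where
  "test_functions \<Omega> = {\<phi>. (\<forall>k. C_k k \<phi>) \<and>
     compact (closure {x. \<phi> x \<noteq> 0}) \<and> closure {x. \<phi> x \<noteq> 0} \<subseteq> \<Omega>}"

definition weak_gradient ::
    "(real^2) set \<Rightarrow> (real^2 \<Rightarrow> 'b::euclidean_space) \<Rightarrow> (real^2 \<Rightarrow> 'b^2) \<Rightarrow> bool" where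
  "weak_gradient \<Omega> v g \<longleftrightarrow> (\<forall>\<phi> \<in> test_functions \<Omega>. \<forall>j.
     (LINT x|lebesgue_on \<Omega>. (\<phi> x :: real) *\<^sub>R (g x $ j)) =
       - (LINT x|lebesgue_on \<Omega>. partial_deriv j \<phi> x *\<^sub>R v x))"

definition H1_0 :: "(real^2) set \<Rightarrow> (real^2 \<Rightarrow> 'b::euclidean_space) set" where
  "H1_0 \<Omega> = {v \<in> L2_space \<Omega>. \<exists>g \<in> L2_space \<Omega>. weak_gradient \<Omega> v g \<and>
     (\<exists>\<phi>. (\<forall>n. \<phi> n \<in> test_functions \<Omega>) \<and>
        (\<lambda>n. L2_norm \<Omega> (\<lambda>x. \<phi> n x - v x)) \<longlonglongrightarrow> 0 \<and>
        (\<lambda>n. L2_norm \<Omega> (\<lambda>x. grad (\<phi> n) x - g x)) \<longlonglongrightarrow> 0)}"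

subsection \<open>Polygons and triangulations\<close>

definition polygonal_curve :: "(real^2) set \<Rightarrow> bool" where
  "polygonal_curve \<Gamma> \<longleftrightarrow>
     (\<exists>\<gamma>. simple_path \<gamma> \<and> pathfinish \<gamma> = pathstart \<gamma> \<and> path_image \<gamma> = \<Gamma>) \<and>
     (\<exists>E. finite E \<and> \<Gamma> = (\<Union>(a, b)\<in>E. closed_segment a b))"

text \<open>Several boundary components are allowed, so a polygon may have polygonal holes.
  As \<open>\<Omega>\<close> is connected, it lies on one side of each boundary curve, which rules out slits.\<close>

definition polygon :: "(real^2) set \<Rightarrow> bool" where
  "polygon \<Omega> \<longleftrightarrow> open \<Omega> \<and> connected \<Omega> \<and> \<Omega> \<noteq> {} \<and>
     (\<exists>\<C>. finite \<C> \<and> (\<forall>\<Gamma>\<in>\<C>. polygonal_curve \<Gamma>) \<and> pairwise disjnt \<C> \<and> frontier \<Omega> = \<Union>\<C>)"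

definition triangulates :: "(real^2) set set \<Rightarrow> (real^2) set \<Rightarrow> bool" where
  "triangulates \<T> \<Omega> \<longleftrightarrow> triangulation \<T> \<and> (\<forall>T\<in>\<T>. 2 simplex T) \<and> \<Union>\<T> = closure \<Omega>"

definition shape_regular :: "real \<Rightarrow> (real^2) set set \<Rightarrow> bool" where
  "shape_regular \<sigma> \<T> \<longleftrightarrow>
     (\<forall>T\<in>\<T>. \<exists>c r. 0 < r \<and> cball c r \<subseteq> T \<and> diameter T \<le> \<sigma> * (2 * r))"

subsection \<open>Local spaces\<close>

text \<open>Polynomials on a triangle are identified with polynomials on the whole plane.\<close>

definition polys :: "nat \<Rightarrow> (real^2 \<Rightarrow> real) set" where
  "polys k = {p. \<exists>c. p = (\<lambda>x. \<Sum>i\<le>k. \<Sum>j\<le>k-i. c i j * (x$1)^i * (x$2)^j)}"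

definition vec_polys :: "nat \<Rightarrow> (real^2 \<Rightarrow> real^2) set" where
  "vec_polys k = {v. \<forall>i. (\<lambda>x. v x $ i) \<in> polys k}"

definition barycentric :: "(real^2) set \<Rightarrow> real^2 \<Rightarrow> real^2 \<Rightarrow> real" where
  "barycentric T z = (THE l. l \<in> polys 1 \<and>
     (\<forall>y. y extreme_point_of T \<longrightarrow> l y = (if y = z then 1 else 0)))"

definition bubble :: "(real^2) set \<Rightarrow> real^2 \<Rightarrow> real" where
  "bubble T x = (\<Prod>z | z extreme_point_of T. barycentric T z x)"

definition unit_normal :: "real^2 \<Rightarrow> (real^2) set \<Rightarrow> bool" where
  "unit_normal n e \<longleftrightarrow> norm n = 1 \<and> (\<forall>x\<in>e. \<forall>y\<in>e. n \<bullet> (x - y) = 0)"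

text \<open>A function on an edge is affine in arclength iff it is the restriction of an affine
  function on the plane.\<close>

definition normal_trace_P1 :: "(real^2) set \<Rightarrow> (real^2 \<Rightarrow> real^2) \<Rightarrow> bool" where
  "normal_trace_P1 T v \<longleftrightarrow> (\<forall>e n. e edge_of T \<and> unit_normal n e \<longrightarrow>
     (\<exists>p \<in> polys 1. \<forall>x\<in>e. v x \<bullet> n = p x))"

definition P2_star :: "(real^2) set \<Rightarrow> (real^2 \<Rightarrow> real^2) set" where
  "P2_star T = {v \<in> vec_polys 2. normal_trace_P1 T v}"

definition P3_star :: "(real^2) set \<Rightarrow> (real^2 \<Rightarrow> real^2) set" where
  "P3_star T = {w \<in> vec_polys 3. divergence w \<in> polys 0 \<and> normal_trace_P1 T w}"

definition W_first :: "(real^2) set \<Rightarrow> (real^2 \<Rightarrow> real^2) set" where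
  "W_first T = {\<lambda>x. p x + bubble T x *\<^sub>R q x | p q. p \<in> vec_polys 2 \<and> q \<in> P2_star T}"

definition W_second :: "(real^2) set \<Rightarrow> (real^2 \<Rightarrow> real^2) set" where
  "W_second T = {\<lambda>x. p x + bubble T x *\<^sub>R q x | p q. p \<in> vec_polys 2 \<and> q \<in> P3_star T}"

subsection \<open>The global space\<close>

text \<open>Given one function \<open>f T\<close> for each triangle \<open>T\<close>, the possible jumps across \<open>e\<close>: the
  difference from the two sides, in either order, and the trace if \<open>e\<close> is on the boundary.\<close>

definition jumps ::
    "(real^2) set \<Rightarrow> (real^2) set set \<Rightarrow> (real^2) set \<Rightarrow> ((real^2) set \<Rightarrow> real^2 \<Rightarrow> real) \<Rightarrow>
     (real^2 \<Rightarrow> real) set" where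
  "jumps \<Omega> \<T> e f =
     {\<lambda>x. f T x - f T' x | T T'. T \<in> \<T> \<and> T' \<in> \<T> \<and> T \<noteq> T' \<and> e edge_of T \<and> e edge_of T'} \<union>
     {f T | T. T \<in> \<T> \<and> e edge_of T \<and> e \<subseteq> frontier \<Omega>}"

text \<open>The moment of order \<open>k\<close> on the segment from \<open>a\<close> to \<open>b\<close>, with arclength \<open>\<tau>\<close> measured
  from \<open>a\<close>; \<open>sgn (b - a)\<close> is the unit tangent.\<close>

definition edge_moment :: "real^2 \<Rightarrow> real^2 \<Rightarrow> nat \<Rightarrow> (real^2 \<Rightarrow> real) \<Rightarrow> real" where
  "edge_moment a b k g = integral {0..dist a b} (\<lambda>\<tau>. g (a + \<tau> *\<^sub>R sgn (b - a)) * \<tau> ^ k)"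

definition normal_deriv :: "real^2 \<Rightarrow> (real^2 \<Rightarrow> real) \<Rightarrow> real^2 \<Rightarrow> real" where
  "normal_deriv n f x = frechet_derivative f (at x) n"

text \<open>Here \<open>w T\<close> is the polynomial that agrees with \<open>v\<close> on the closed triangle \<open>T\<close>, so \<open>v\<close> is
  the continuous representative of its class. This and the membership in \<^const>\<open>H1_0\<close> account for
  the degrees of freedom at vertices and midpoints. The moment conditions do not depend on the
  orientation of the edge nor on the sign of the normal.\<close>

definition V_h ::
    "((real^2) set \<Rightarrow> (real^2 \<Rightarrow> real^2) set) \<Rightarrow> (real^2) set \<Rightarrow> (real^2) set set \<Rightarrow>
     (real^2 \<Rightarrow> real^2) set" where
  "V_h W \<Omega> \<T> = {v \<in> H1_0 \<Omega>. \<exists>w.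
     (\<forall>T\<in>\<T>. w T \<in> W T \<and> (\<forall>x\<in>T. v x = w T x)) \<and>
     (\<forall>T\<in>\<T>. \<forall>a b n. closed_segment a b edge_of T \<and> unit_normal n (closed_segment a b) \<longrightarrow>
        (\<forall>k\<in>{0,1}. \<forall>g \<in> jumps \<Omega> \<T> (closed_segment a b)
           (\<lambda>T. normal_deriv n (\<lambda>x. w T x \<bullet> n)). edge_moment a b k g = 0) \<and>
        (\<forall>g \<in> jumps \<Omega> \<T> (closed_segment a b)
           (\<lambda>T. normal_deriv n (\<lambda>x. w T x \<bullet> sgn (b - a))). edge_moment a b 0 g = 0))}"

subsection \<open>Broken norms\<close>

text \<open>Interiors are taken because \<^const>\<open>frechet_derivative\<close> at a point of an edge is
  not the derivative of the restriction to one triangle.\<close>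

definition broken_L2_norm ::
    "(real^2) set set \<Rightarrow> (real^2 \<Rightarrow> 'b::euclidean_space) \<Rightarrow> real" where
  "broken_L2_norm \<T> f = sqrt (\<Sum>T\<in>\<T>. (L2_norm (interior T) f)\<^sup>2)"

definition H2_h_norm :: "(real^2) set \<Rightarrow> (real^2) set set \<Rightarrow> (real^2 \<Rightarrow> real^2) \<Rightarrow> real" where
  "H2_h_norm \<Omega> \<T> v =
     L2_norm \<Omega> v + (broken_L2_norm \<T> (grad v) + broken_L2_norm \<T> (grad (grad v)))"

end

theory Submission
  imports Defs
begin

text \<open>The estimate splits into a pointwise identity and two classical inequalities.

Second derivatives are controlled triangle by triangle. Inside a triangle \<open>v\<close> is a polynomial, and
since mixed derivatives commute,
\<open>\<partial>\<^sub>k \<partial>\<^sub>j v\<^sub>i = \<partial>\<^sub>k \<epsilon>\<^sub>i\<^sub>j + \<partial>\<^sub>j \<epsilon>\<^sub>i\<^sub>k - \<partial>\<^sub>i \<epsilon>\<^sub>j\<^sub>k\<close>: the strain determines all second derivatives, and the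
Hessian of \<open>v\<close> is bounded by the gradient of its strain at every point
(\<open>norm_second_gradient_le\<close>).

The lower-order terms are controlled globally, by the fact that \<open>v\<close> lies in \<^const>\<open>H1_0\<close>. For a test
function, Korn's inequality \<open>\<parallel>\<nabla>\<phi>\<parallel> \<le> sqrt 2 \<parallel>\<epsilon>(\<phi>)\<parallel>\<close> holds because
\<open>2 |\<epsilon>(\<phi>)|\<^sup>2 = |\<nabla>\<phi>|\<^sup>2 + (div \<phi>)\<^sup>2 - 2 det \<nabla>\<phi>\<close> and the determinant is a divergence, which
integrates to zero (\<open>Korn_test_function\<close>); Poincare's inequality follows from
\<open>\<integral> \<partial>\<^sub>1 (x\<^sub>1 |\<phi>|\<^sup>2) = 0\<close> (\<open>Poincare_test_function\<close>). Both pass to the limit in \<open>H\<^sup>1\<close>, which gives them for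
\<open>v\<close> and its weak gradient.

It remains to see that the weak gradient of \<open>v\<close> is its elementwise gradient. This is local:
on a ball inside a triangle the approximating test functions converge in \<open>L\<^sup>2\<close> to a polynomial \<open>w\<close>,
their gradients converge in \<open>L\<^sup>2\<close>, and integration by parts against a \<open>C\<^sup>1\<close> cutoff shows that the
limit is \<open>\<nabla>w\<close> (\<open>H1_limit_gradient_on_ball\<close>). The edges of the triangulation and the boundary of the
polygon are null sets, so nothing is lost there.\<close>

section \<open>Derivatives, and symmetry of second derivatives\<close>

lemma partial_deriv_eqI:
  assumes "(f has_derivative f') (at x)"
  shows "partial_deriv j f x = f' (axis j 1)"
  using frechet_derivative_at[OF assms] by (simp add: partial_deriv_def)

lemma C_k_imp_differentiable: "C_k (Suc k) f \<Longrightarrow> f differentiable (at x)"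
  by simp

lemma C_k_SucD: "C_k (Suc k) f \<Longrightarrow> C_k k f"
proof (induction k arbitrary: f)
  case 0
  then show ?case
    by (auto intro!: continuous_at_imp_continuous_on differentiable_imp_continuous_within)
next
  case (Suc k)
  then show ?case by (metis C_k.simps(2))
qed

lemma C_k_imp_continuous: "C_k k f \<Longrightarrow> continuous_on S f"
proof (induction k arbitrary: f)
  case 0
  then show ?case by (auto intro: continuous_on_subset)
next
  case (Suc k)
  then show ?case using C_k_SucD by blast
qed

lemma partial_deriv_linear:
  assumes "bounded_linear L" "f differentiable (at x)"
  shows "partial_deriv j (\<lambda>x. L (f x)) x = L (partial_deriv j f x)"
proof -
  have "(f has_derivative frechet_derivative f (at x)) (at x)"
    using assms(2) frechet_derivative_works by blast
  then have "((\<lambda>x. L (f x)) has_derivative (\<lambda>h. L (frechet_derivative f (at x) h))) (at x)"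
    using assms(1) bounded_linear.has_derivative by blast
  then show ?thesis
    by (subst partial_deriv_eqI) (simp_all add: partial_deriv_def)
qed

lemma C_k_linear: "bounded_linear L \<Longrightarrow> C_k k f \<Longrightarrow> C_k k (\<lambda>x. L (f x))"
proof (induction k arbitrary: f)
  case 0
  then show ?case by (auto intro: bounded_linear.continuous_on)
next
  case (Suc k)
  have "partial_deriv j (\<lambda>x. L (f x)) = (\<lambda>x. L (partial_deriv j f x))" for j
    using Suc.prems by (auto simp: partial_deriv_linear)
  moreover have "(\<lambda>x. L (f x)) differentiable (at x)" for x
  proof -
    obtain f' where "(f has_derivative f') (at x)"
      using Suc.prems(2) unfolding C_k.simps differentiable_def by blast
    from bounded_linear.has_derivative[OF Suc.prems(1) this] show ?thesis
      unfolding differentiable_def by blast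
  qed
  ultimately show ?case
    using Suc by simp
qed

lemma partial_deriv_bilinear:
  assumes "bounded_bilinear B" "f differentiable (at x)" "g differentiable (at x)"
  shows "partial_deriv j (\<lambda>x. B (f x) (g x)) x = B (partial_deriv j f x) (g x) + B (f x) (partial_deriv j g x)"
proof -
  have "(f has_derivative frechet_derivative f (at x)) (at x)"
       "(g has_derivative frechet_derivative g (at x)) (at x)"
    using assms frechet_derivative_works by blast+
  from partial_deriv_eqI[OF bounded_bilinear.FDERIV[OF assms(1) this]] show ?thesis
    by (simp add: partial_deriv_def add.commute)
qed

lemma partial_deriv_add:
  assumes "f differentiable (at x)" "g differentiable (at x)"
  shows "partial_deriv j (\<lambda>x. f x + g x) x = partial_deriv j f x + partial_deriv j g x"
proof -
  have "(f has_derivative frechet_derivative f (at x)) (at x)"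
       "(g has_derivative frechet_derivative g (at x)) (at x)"
    using assms frechet_derivative_works by blast+
  from partial_deriv_eqI[OF has_derivative_add[OF this]] show ?thesis
    by (simp add: partial_deriv_def)
qed

lemma partial_deriv_diff:
  assumes "f differentiable (at x)" "g differentiable (at x)"
  shows "partial_deriv j (\<lambda>x. f x - g x) x = partial_deriv j f x - partial_deriv j g x"
proof -
  have "(f has_derivative frechet_derivative f (at x)) (at x)"
       "(g has_derivative frechet_derivative g (at x)) (at x)"
    using assms frechet_derivative_works by blast+
  from partial_deriv_eqI[OF has_derivative_diff[OF this]] show ?thesis
    by (simp add: partial_deriv_def)
qed

lemma C_k_diff: "C_k k f \<Longrightarrow> C_k k g \<Longrightarrow> C_k k (\<lambda>x. f x - g x)"
proof (induction k arbitrary: f g)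
  case 0
  then show ?case by (auto intro: continuous_intros)
next
  case (Suc k)
  then have "partial_deriv j (\<lambda>x. f x - g x) = (\<lambda>x. partial_deriv j f x - partial_deriv j g x)" for j
    by (auto simp: partial_deriv_diff)
  with Suc show ?case by simp
qed

lemma C_1_bilinear:
  assumes "bounded_bilinear B" "C_k 1 f" "C_k 1 g"
  shows "C_k 1 (\<lambda>x. B (f x) (g x))"
proof -
  have "partial_deriv j (\<lambda>x. B (f x) (g x)) = (\<lambda>x. B (partial_deriv j f x) (g x) + B (f x) (partial_deriv j g x))" for j
    using assms partial_deriv_bilinear by fastforce
  moreover have "continuous_on UNIV (\<lambda>x. B (partial_deriv j f x) (g x) + B (f x) (partial_deriv j g x))" for j
    using assms C_k_imp_continuous[of 1 f UNIV] C_k_imp_continuous[of 1 g UNIV]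
    by (auto intro!: continuous_intros bounded_bilinear.continuous_on[OF assms(1)])
  moreover have "(\<lambda>x. B (f x) (g x)) differentiable (at x)" for x
  proof -
    obtain f' g' where "(f has_derivative f') (at x)" "(g has_derivative g') (at x)"
      using assms(2,3) unfolding One_nat_def C_k.simps differentiable_def by blast
    from bounded_bilinear.FDERIV[OF assms(1) this] show ?thesis
      unfolding differentiable_def by blast
  qed
  ultimately show ?thesis by simp
qed

lemma partial_deriv_cong_open:
  assumes "open S" "x \<in> S" "\<And>y. y \<in> S \<Longrightarrow> f y = g y"
  shows "partial_deriv j f x = partial_deriv j g x"
proof -
  have "(f has_derivative f') (at x) \<longleftrightarrow> (g has_derivative f') (at x)" for f'
    using assms has_derivative_transform_within_open[of f f' x UNIV S g]
      has_derivative_transform_within_open[of g f' x UNIV S f] by auto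
  then show ?thesis
    unfolding partial_deriv_def frechet_derivative_def by simp
qed

lemma partial_deriv_outside:
  assumes "closed K" "x \<notin> K" "\<And>y. y \<notin> K \<Longrightarrow> f y = 0"
  shows "partial_deriv j f x = 0"
proof -
  have "partial_deriv j f x = partial_deriv j (\<lambda>_. 0) x"
    using assms by (intro partial_deriv_cong_open[of "-K"]) auto
  then show ?thesis by (simp add: partial_deriv_def)
qed

lemma partial_deriv_const [simp]: "partial_deriv j (\<lambda>x. c) x = 0"
  by (simp add: partial_deriv_def)

lemma real_polynomial_function_partial_deriv:
  assumes "real_polynomial_function p"
  shows "real_polynomial_function (partial_deriv j p)"
  using assms
proof induction
  case (linear f)
  then have "partial_deriv j f = (\<lambda>x. f (axis j 1))"
    by (auto simp: partial_deriv_eqI bounded_linear_imp_has_derivative)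
  then show ?case by auto
next
  case (const c)
  have "partial_deriv j (\<lambda>x. c) = (\<lambda>x. 0)" by auto
  then show ?case by auto
next
  case (add f g)
  then have "partial_deriv j (\<lambda>x. f x + g x) = (\<lambda>x. partial_deriv j f x + partial_deriv j g x)"
    by (intro ext partial_deriv_add differentiable_at_real_polynomial_function)
  with add show ?case by auto
next
  case (mult f g)
  then have "partial_deriv j (\<lambda>x. f x * g x) = (\<lambda>x. partial_deriv j f x * g x + f x * partial_deriv j g x)"
    by (intro ext partial_deriv_bilinear bounded_bilinear_mult differentiable_at_real_polynomial_function)
  with mult show ?case by auto
qed

text \<open>The partial derivatives of a polynomial are polynomials; vector-valued polynomials are
treated component by component.\<close>

lemma polynomial_function_imp_C_k:
  fixes p :: "real^2 \<Rightarrow> 'b::euclidean_space"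
  shows "polynomial_function p \<Longrightarrow> C_k k p"
proof (induction k arbitrary: p)
  case 0
  then show ?case
    by (simp add: continuous_on_polymonial_function)
next
  case (Suc k)
  have d: "p differentiable (at x)" for x
    using Suc.prems differentiable_at_polynomial_function by blast
  have "polynomial_function (partial_deriv j p)" for j
  proof (subst polynomial_function_iff_Basis_inner, intro ballI)
    fix b :: 'b assume "b \<in> Basis"
    then have "real_polynomial_function (\<lambda>x. p x \<bullet> b)"
      using Suc.prems by (simp add: polynomial_function_iff_Basis_inner)
    moreover have "partial_deriv j (\<lambda>x. p x \<bullet> b) = (\<lambda>x. partial_deriv j p x \<bullet> b)"
      using d partial_deriv_linear[OF bounded_linear_inner_left] by blast
    ultimately show "real_polynomial_function (\<lambda>x. partial_deriv j p x \<bullet> b)"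
      by (metis real_polynomial_function_partial_deriv)
  qed
  with d Suc.IH show ?case by simp
qed

lemma has_real_derivative_along_axis:
  fixes f :: "real^2 \<Rightarrow> real"
  assumes "\<And>x. f differentiable (at x)"
  shows "((\<lambda>t. f (x + t *\<^sub>R axis j 1)) has_real_derivative partial_deriv j f (x + t *\<^sub>R axis j 1)) (at t)"
proof -
  have "(f has_derivative frechet_derivative f (at (x + t *\<^sub>R axis j 1))) (at (x + t *\<^sub>R axis j 1))"
    using assms frechet_derivative_works by blast
  moreover have "((\<lambda>t. x + t *\<^sub>R axis j 1) has_derivative (\<lambda>h. h *\<^sub>R axis j 1)) (at t)"
    by (auto intro!: derivative_eq_intros)
  ultimately have "((\<lambda>t. f (x + t *\<^sub>R axis j 1)) has_derivative
      (\<lambda>h. frechet_derivative f (at (x + t *\<^sub>R axis j 1)) (h *\<^sub>R axis j 1))) (at t)"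
    using has_derivative_compose by fast
  moreover have "(\<lambda>h. frechet_derivative f (at (x + t *\<^sub>R axis j 1)) (h *\<^sub>R axis j 1)) =
     (\<lambda>h. partial_deriv j f (x + t *\<^sub>R axis j 1) * h)"
    using assms linear_frechet_derivative[of f] by (auto simp: partial_deriv_def linear_cmul)
  ultimately show ?thesis
    by (simp add: has_field_derivative_def)
qed

text \<open>By the mean value theorem in direction \<open>i\<close>, then in direction \<open>j\<close>. The left-hand side is symmetric in
\<open>i\<close> and \<open>j\<close>, so applying this in both orders compares the two mixed derivatives at nearby points.\<close>

lemma second_difference:
  fixes f :: "real^2 \<Rightarrow> real"
  assumes "C_k 2 f" "0 < h"
  obtains s t where "0 < s" "s < h" "0 < t" "t < h"
    "f (x + h *\<^sub>R axis i 1 + h *\<^sub>R axis j 1) - f (x + h *\<^sub>R axis i 1) - f (x + h *\<^sub>R axis j 1) + f x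
      = h\<^sup>2 * partial_deriv j (partial_deriv i f) (x + s *\<^sub>R axis i 1 + t *\<^sub>R axis j 1)"
proof -
  define e where "e = (axis i 1 :: real^2)"
  define d where "d = (axis j 1 :: real^2)"
  have df: "\<And>x. f differentiable (at x)" and ddf: "\<And>x. partial_deriv i f differentiable (at x)"
    using assms by (auto simp: numeral_2_eq_2)
  define g where "g s = f ((x + h *\<^sub>R d) + s *\<^sub>R e) - f (x + s *\<^sub>R e)" for s
  have "\<exists>s>0. s < h \<and> g h - g 0 = (h - 0) * (partial_deriv i f ((x + h *\<^sub>R d) + s *\<^sub>R e) - partial_deriv i f (x + s *\<^sub>R e))"
    unfolding g_def e_def using assms(2)
    by (intro MVT2) (auto intro!: DERIV_diff has_real_derivative_along_axis df)
  then obtain s where s: "0 < s" "s < h"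
     "g h - g 0 = h * (partial_deriv i f ((x + h *\<^sub>R d) + s *\<^sub>R e) - partial_deriv i f (x + s *\<^sub>R e))" by auto
  have "\<exists>t>0. t < h \<and> partial_deriv i f ((x + s *\<^sub>R e) + h *\<^sub>R d) - partial_deriv i f ((x + s *\<^sub>R e) + 0 *\<^sub>R d) 
        = (h - 0) * partial_deriv j (partial_deriv i f) ((x + s *\<^sub>R e) + t *\<^sub>R d)"
    unfolding d_def using assms(2)
    by (intro MVT2) (auto intro!: has_real_derivative_along_axis ddf)
  then obtain t where t: "0 < t" "t < h"
    "partial_deriv i f ((x + s *\<^sub>R e) + h *\<^sub>R d) - partial_deriv i f (x + s *\<^sub>R e) 
        = h * partial_deriv j (partial_deriv i f) ((x + s *\<^sub>R e) + t *\<^sub>R d)" by auto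
  show ?thesis
  proof (rule that[OF s(1,2) t(1,2)], fold e_def d_def)
    show "f (x + h *\<^sub>R e + h *\<^sub>R d) - f (x + h *\<^sub>R e) - f (x + h *\<^sub>R d) + f x =
      h\<^sup>2 * partial_deriv j (partial_deriv i f) (x + s *\<^sub>R e + t *\<^sub>R d)"
      using s(3) t(3) unfolding g_def by (simp add: power2_eq_square algebra_simps)
  qed
qed

lemma partial_deriv_commute:
  fixes f :: "real^2 \<Rightarrow> real"
  assumes "C_k 2 f"
  shows "partial_deriv i (partial_deriv j f) x = partial_deriv j (partial_deriv i f) x"
proof (rule ccontr)
  define F where "F = partial_deriv i (partial_deriv j f)"
  define G where "G = partial_deriv j (partial_deriv i f)"
  assume "\<not> ?thesis"
  then have ne: "F x \<noteq> G x" by (simp add: F_def G_def)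
  define e where "e = dist (F x) (G x) / 2"
  have e: "e > 0" using ne by (simp add: e_def)
  have "isCont F x" "isCont G x"
    using assms by (simp_all add: F_def G_def numeral_2_eq_2 continuous_on_eq_continuous_at)
  then obtain d1 d2 where d: "d1 > 0" "\<And>y. dist y x < d1 \<Longrightarrow> dist (F y) (F x) < e"
       "d2 > 0" "\<And>y. dist y x < d2 \<Longrightarrow> dist (G y) (G x) < e"
    using e unfolding continuous_at_eps_delta by metis
  define h where "h = min d1 d2 / 2"
  have h: "h > 0" using d by (simp add: h_def)
  have near: "dist (x + s *\<^sub>R axis k 1 + t *\<^sub>R axis l 1) x < min d1 d2"
    if "0 < s" "s < h" "0 < t" "t < h" for s t and k l :: 2
  proof -
    have "norm (s *\<^sub>R axis k (1::real) + t *\<^sub>R axis l 1) \<le> \<bar>s\<bar> + \<bar>t\<bar>"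
      by (rule order.trans[OF norm_triangle_ineq]) (simp add: norm_axis_1)
    then show ?thesis using that by (simp add: dist_norm h_def add.assoc)
  qed
  let ?D = "f (x + h *\<^sub>R axis i 1 + h *\<^sub>R axis j 1) - f (x + h *\<^sub>R axis i 1) - f (x + h *\<^sub>R axis j 1) + f x"
  obtain s t where 1: "0 < s" "s < h" "0 < t" "t < h" "?D = h\<^sup>2 * G (x + s *\<^sub>R axis i 1 + t *\<^sub>R axis j 1)"
    unfolding G_def using second_difference[OF assms h] by blast
  obtain s' t' where 2: "0 < s'" "s' < h" "0 < t'" "t' < h" "?D = h\<^sup>2 * F (x + s' *\<^sub>R axis j 1 + t' *\<^sub>R axis i 1)"
    unfolding F_def using second_difference[OF assms h, of x j i] by (smt (verit) add.commute add.left_commute)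
  have "F (x + s' *\<^sub>R axis j 1 + t' *\<^sub>R axis i 1) = G (x + s *\<^sub>R axis i 1 + t *\<^sub>R axis j 1)"
    using 1(5) 2(5) h by simp
  then have "dist (F x) (G x) < e + e"
    using d(2)[of "x + s' *\<^sub>R axis j 1 + t' *\<^sub>R axis i 1"] d(4)[of "x + s *\<^sub>R axis i 1 + t *\<^sub>R axis j 1"]
      near[OF 1(1-4), of i j] near[OF 2(1-4), of j i] by (smt (verit) dist_commute dist_triangle)
  then show False by (simp add: e_def)
qed

lemma grad_cong_open:
  assumes "open S" "x \<in> S" "\<And>y. y \<in> S \<Longrightarrow> f y = h y"
  shows "grad f x = grad h x"
  unfolding grad_def using partial_deriv_cong_open[OF assms] by simp

section \<open>Square-integrable functions\<close>

lemma L2_norm_nonneg: "0 \<le> L2_norm S f"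
  unfolding L2_norm_def by simp

lemma L2_norm_square: "(L2_norm S f)\<^sup>2 = (LINT x|lebesgue_on S. (norm (f x))\<^sup>2)"
  unfolding L2_norm_def by (simp add: integral_nonneg_AE)

lemma L2_spaceD:
  assumes "f \<in> L2_space S"
  shows "f \<in> borel_measurable (lebesgue_on S)" "integrable (lebesgue_on S) (\<lambda>x. (norm (f x))\<^sup>2)"
  using assms unfolding L2_space_def by auto

lemma L2_spaceI_bound:
  assumes "f \<in> borel_measurable (lebesgue_on S)" "integrable (lebesgue_on S) h"
    "\<And>x. x \<in> S \<Longrightarrow> (norm (f x))\<^sup>2 \<le> h x"
  shows "f \<in> L2_space S"
proof -
  have "integrable (lebesgue_on S) (\<lambda>x. (norm (f x))\<^sup>2)"
    by (rule Bochner_Integration.integrable_bound[OF assms(2)])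
       (use assms(1,3) order.trans[OF zero_le_power2] in \<open>force intro!: AE_I2 simp: space_restrict_space\<close>)+
  with assms(1) show ?thesis unfolding L2_space_def by simp
qed

lemma L2_space_integrable_inner:
  assumes "f \<in> L2_space S" "h \<in> L2_space S"
  shows "integrable (lebesgue_on S) (\<lambda>x. f x \<bullet> h x)"
proof (rule Bochner_Integration.integrable_bound)
  show "integrable (lebesgue_on S) (\<lambda>x. (norm (f x))\<^sup>2 + (norm (h x))\<^sup>2)"
    using L2_spaceD(2)[OF assms(1)] L2_spaceD(2)[OF assms(2)] by simp
  show "(\<lambda>x. f x \<bullet> h x) \<in> borel_measurable (lebesgue_on S)"
    using borel_measurable_inner[OF L2_spaceD(1)[OF assms(1)] L2_spaceD(1)[OF assms(2)]] .
  have "\<bar>f x \<bullet> h x\<bar> \<le> (norm (f x))\<^sup>2 + (norm (h x))\<^sup>2" for x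
    using Cauchy_Schwarz_ineq2[of "f x" "h x"] sum_squares_bound[of "norm (f x)" "norm (h x)"]
      mult_nonneg_nonneg[OF norm_ge_zero[of "f x"] norm_ge_zero[of "h x"]] by linarith
  then show "AE x in lebesgue_on S. norm (f x \<bullet> h x) \<le> norm ((norm (f x))\<^sup>2 + (norm (h x))\<^sup>2)"
    by simp
qed

lemma L2_space_linear:
  assumes "f \<in> L2_space S" "bounded_linear L"
  shows "(\<lambda>x. L (f x)) \<in> L2_space S"
proof -
  obtain K where K: "\<And>x. norm (L x) \<le> norm x * K"
    using assms(2) bounded_linear.bounded by blast
  show ?thesis
  proof (rule L2_spaceI_bound)
    show "(\<lambda>x. L (f x)) \<in> borel_measurable (lebesgue_on S)"
      using measurable_compose[OF L2_spaceD(1)[OF assms(1)]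
          borel_measurable_continuous_onI[OF linear_continuous_on[OF assms(2)]]] .
    show "integrable (lebesgue_on S) (\<lambda>x. K\<^sup>2 * (norm (f x))\<^sup>2)"
      using L2_spaceD(2)[OF assms(1)] by simp
    show "(norm (L (f x)))\<^sup>2 \<le> K\<^sup>2 * (norm (f x))\<^sup>2" for x
      using power_mono[OF K[of "f x"], of 2] by (simp add: power_mult_distrib mult.commute)
  qed
qed

lemma L2_space_diff:
  assumes "f \<in> L2_space S" "h \<in> L2_space S"
  shows "(\<lambda>x. f x - h x) \<in> L2_space S"
proof (rule L2_spaceI_bound)
  show "(\<lambda>x. f x - h x) \<in> borel_measurable (lebesgue_on S)"
    using borel_measurable_diff[OF L2_spaceD(1)[OF assms(1)] L2_spaceD(1)[OF assms(2)]] .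
  show "integrable (lebesgue_on S) (\<lambda>x. 2 * (norm (f x))\<^sup>2 + 2 * (norm (h x))\<^sup>2)"
    using L2_spaceD(2)[OF assms(1)] L2_spaceD(2)[OF assms(2)] by simp
  show "(norm (f x - h x))\<^sup>2 \<le> 2 * (norm (f x))\<^sup>2 + 2 * (norm (h x))\<^sup>2" for x
    using power_mono[OF norm_triangle_ineq4[of "f x" "h x"], of 2] sum_squares_bound[of "norm (f x)" "norm (h x)"]
    by (simp add: power2_sum)
qed

text \<open>The quadratic polynomial \<open>\<parallel>f - t h\<parallel>\<^sup>2\<close> in \<open>t\<close> is nonnegative, so its discriminant is not positive.\<close>

lemma L2_norm_Cauchy_Schwarz:
  assumes f: "f \<in> L2_space S" and h: "h \<in> L2_space S"
  shows "\<bar>LINT x|lebesgue_on S. f x \<bullet> h x\<bar> \<le> L2_norm S f * L2_norm S h"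
proof -
  define F where "F = (L2_norm S f)\<^sup>2"
  define H where "H = (L2_norm S h)\<^sup>2"
  define P where "P = (LINT x|lebesgue_on S. f x \<bullet> h x)"
  have quad: "0 \<le> F - 2 * t * P + t\<^sup>2 * H" for t
  proof -
    have "0 \<le> (LINT x|lebesgue_on S. (norm (f x - t *\<^sub>R h x))\<^sup>2)"
      by (simp add: integral_nonneg_AE)
    also have "\<dots> = (LINT x|lebesgue_on S. (norm (f x))\<^sup>2 - 2 * t * (f x \<bullet> h x) + t\<^sup>2 * (norm (h x))\<^sup>2)"
      by (intro Bochner_Integration.integral_cong)
         (simp_all add: power2_norm_eq_inner inner_diff inner_commute power2_eq_square[of t] algebra_simps)
    also have "\<dots> = F - 2 * t * P + t\<^sup>2 * H"
      using L2_spaceD(2)[OF f] L2_spaceD(2)[OF h] L2_space_integrable_inner[OF f h]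
      by (simp add: F_def H_def P_def L2_norm_square)
    finally show ?thesis .
  qed
  have "P\<^sup>2 \<le> F * H"
  proof (cases "H = 0")
    case True
    have "P = 0"
    proof (rule ccontr)
      assume "P \<noteq> 0"
      (* This t makes the affine function F - 2 t P equal to -1. *)
      then show False using quad[of "(F + 1) / (2 * P)"] True by (simp add: field_simps)
    qed
    then show ?thesis using True by simp
  next
    case False
    then have "H > 0" by (simp add: H_def)
    (* The polynomial attains its minimum at t = P / H. *)
    have "0 \<le> (F - 2 * (P / H) * P + (P / H)\<^sup>2 * H) * H"
      using quad[of "P / H"] \<open>H > 0\<close> by simp
    also have "\<dots> = F * H - P\<^sup>2"
      using \<open>H > 0\<close> by (simp add: field_simps power2_eq_square)
    finally show ?thesis by simp
  qed
  then have "\<bar>P\<bar>\<^sup>2 \<le> (L2_norm S f * L2_norm S h)\<^sup>2"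
    by (simp add: F_def H_def power_mult_distrib)
  then show ?thesis
    unfolding P_def[symmetric] by (rule power2_le_imp_le) (simp add: L2_norm_nonneg)
qed

lemma L2_norm_triangle_sub:
  assumes f: "f \<in> L2_space S" and h: "h \<in> L2_space S"
  shows "L2_norm S f \<le> L2_norm S h + L2_norm S (\<lambda>x. f x - h x)"
proof -
  let ?d = "\<lambda>x. f x - h x"
  have d: "?d \<in> L2_space S" using L2_space_diff[OF f h] .
  have "(L2_norm S f)\<^sup>2 = (LINT x|lebesgue_on S. (norm (h x))\<^sup>2 + 2 * (h x \<bullet> ?d x) + (norm (?d x))\<^sup>2)"
    unfolding L2_norm_square
    by (intro Bochner_Integration.integral_cong) (auto simp: power2_norm_eq_inner inner_diff inner_commute)
  also have "\<dots> = (L2_norm S h)\<^sup>2 + 2 * (LINT x|lebesgue_on S. h x \<bullet> ?d x) + (L2_norm S ?d)\<^sup>2"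
    using L2_spaceD(2)[OF d] L2_spaceD(2)[OF h] L2_space_integrable_inner[OF h d]
    by (simp add: L2_norm_square)
  also have "\<dots> \<le> (L2_norm S h + L2_norm S ?d)\<^sup>2"
    using L2_norm_Cauchy_Schwarz[OF h d] by (simp add: power2_sum)
  finally show ?thesis
    by (rule power2_le_imp_le) (simp add: L2_norm_nonneg)
qed

lemma L2_norm_minus_commute: "L2_norm S (\<lambda>x. f x - h x) = L2_norm S (\<lambda>x. h x - f x)"
  by (simp add: L2_norm_def norm_minus_commute)

lemma L2_norm_tendsto:
  assumes f: "\<And>n. f n \<in> L2_space S" and h: "h \<in> L2_space S"
    and lim: "(\<lambda>n. L2_norm S (\<lambda>x. f n x - h x)) \<longlonglongrightarrow> 0"
  shows "(\<lambda>n. L2_norm S (f n)) \<longlonglongrightarrow> L2_norm S h"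
proof (rule LIM_zero_cancel, rule Lim_null_comparison)
  show "\<forall>\<^sub>F n in sequentially. norm (L2_norm S (f n) - L2_norm S h) \<le> L2_norm S (\<lambda>x. f n x - h x)"
    using L2_norm_triangle_sub[OF f h] L2_norm_triangle_sub[OF h f]
    by (auto intro!: always_eventually simp: abs_le_iff L2_norm_minus_commute[of S h] algebra_simps)
qed (rule lim)

text \<open>Strong convergence in \<open>L\<^sup>2\<close> implies weak convergence.\<close>

lemma L2_inner_tendsto:
  assumes f: "\<And>n. f n \<in> L2_space S" and g: "g \<in> L2_space S" and h: "h \<in> L2_space S"
    and lim: "(\<lambda>n. L2_norm S (\<lambda>x. f n x - g x)) \<longlonglongrightarrow> 0"
  shows "(\<lambda>n. LINT x|lebesgue_on S. f n x \<bullet> h x) \<longlonglongrightarrow> (LINT x|lebesgue_on S. g x \<bullet> h x)"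
proof (rule LIM_zero_cancel, rule Lim_null_comparison)
  show "\<forall>\<^sub>F n in sequentially. norm ((LINT x|lebesgue_on S. f n x \<bullet> h x) - (LINT x|lebesgue_on S. g x \<bullet> h x))
      \<le> L2_norm S (\<lambda>x. f n x - g x) * L2_norm S h"
    using L2_norm_Cauchy_Schwarz[OF L2_space_diff[OF f g] h]
      L2_space_integrable_inner[OF f h] L2_space_integrable_inner[OF g h]
    by (auto intro!: always_eventually simp: inner_diff_left)
  show "(\<lambda>n. L2_norm S (\<lambda>x. f n x - g x) * L2_norm S h) \<longlonglongrightarrow> 0"
    using tendsto_mult_left_zero[OF lim] .
qed

lemma L2_norm_linear_tendsto:
  assumes f: "\<And>n. f n \<in> L2_space S" and h: "h \<in> L2_space S" and L: "bounded_linear L"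
    and lim: "(\<lambda>n. L2_norm S (\<lambda>x. f n x - h x)) \<longlonglongrightarrow> 0"
  shows "(\<lambda>n. L2_norm S (\<lambda>x. L (f n x) - L (h x))) \<longlonglongrightarrow> 0"
proof -
  obtain K where K: "\<And>x. norm (L x) \<le> norm x * K" "K > 0"
    using L bounded_linear.pos_bounded by blast
  have "L2_norm S (\<lambda>x. L (f n x) - L (h x)) \<le> K * L2_norm S (\<lambda>x. f n x - h x)" for n
  proof (rule power2_le_imp_le)
    have d: "(\<lambda>x. f n x - h x) \<in> L2_space S" using L2_space_diff[OF f h] .
    have eq: "(\<lambda>x. L (f n x) - L (h x)) = (\<lambda>x. L (f n x - h x))"
      using L bounded_linear.linear linear_diff by metis
    have "(norm (L (f n x - h x)))\<^sup>2 \<le> K\<^sup>2 * (norm (f n x - h x))\<^sup>2" for x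
      using power_mono[OF K(1)[of "f n x - h x"], of 2] by (simp add: power_mult_distrib mult.commute)
    then have "(LINT x|lebesgue_on S. (norm (L (f n x - h x)))\<^sup>2) \<le> (LINT x|lebesgue_on S. K\<^sup>2 * (norm (f n x - h x))\<^sup>2)"
      using Bochner_Integration.integral_mono[OF L2_spaceD(2)[OF L2_space_linear[OF d L]]
          integrable_mult_right[OF L2_spaceD(2)[OF d]]] by simp
    then show "(L2_norm S (\<lambda>x. L (f n x) - L (h x)))\<^sup>2 \<le> (K * L2_norm S (\<lambda>x. f n x - h x))\<^sup>2"
      by (simp add: L2_norm_square power_mult_distrib eq)
    show "0 \<le> K * L2_norm S (\<lambda>x. f n x - h x)"
      using K(2) by (simp add: L2_norm_nonneg)
  qed
  moreover have "(\<lambda>n. K * L2_norm S (\<lambda>x. f n x - h x)) \<longlonglongrightarrow> 0"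
    using tendsto_mult_right_zero[OF lim] .
  ultimately have "\<forall>n. L2_norm S (\<lambda>x. L (f n x) - L (h x)) \<le> K * L2_norm S (\<lambda>x. f n x - h x)"
      "(\<lambda>n. K * L2_norm S (\<lambda>x. f n x - h x)) \<longlonglongrightarrow> 0" by blast+
  then show ?thesis
    using tendsto_sandwich[of "\<lambda>_. 0" "\<lambda>n. L2_norm S (\<lambda>x. L (f n x) - L (h x))" sequentially
       "\<lambda>n. K * L2_norm S (\<lambda>x. f n x - h x)" 0] by (simp add: L2_norm_nonneg)
qed

lemma continuous_in_L2_space:
  assumes "open S" "bounded S" "continuous_on UNIV f"
  shows "f \<in> L2_space S"
proof -
  have "bounded (f ` closure S)"
    using compact_imp_bounded[OF compact_continuous_image[OF continuous_on_subset[OF assms(3) subset_UNIV]]]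
      assms(2) compact_closure by blast
  then obtain M where M: "\<And>x. x \<in> closure S \<Longrightarrow> norm (f x) \<le> M"
    unfolding bounded_iff by blast
  have S: "S \<in> sets lebesgue" "S \<in> lmeasurable"
    using assms by (auto simp: bounded_set_imp_lmeasurable)
  show ?thesis
  proof (rule L2_spaceI_bound)
    show "f \<in> borel_measurable (lebesgue_on S)"
      using assms(3) S by (intro continuous_imp_measurable_on_sets_lebesgue) (auto intro: continuous_on_subset)
    show "integrable (lebesgue_on S) (\<lambda>x. M\<^sup>2)"
    proof -
      have "integrable lebesgue (\<lambda>x. indicat_real S x *\<^sub>R M\<^sup>2)"
        using S(2) by (simp add: lmeasurable_iff_integrable)
      then show ?thesis
        using S(1) by (subst integrable_restrict_space) auto
    qed
    show "(norm (f x))\<^sup>2 \<le> M\<^sup>2" if "x \<in> S" for x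
      using M[of x] that closure_subset[of S] by (intro power_mono) auto
  qed
qed

lemma L2_norm_mono:
  fixes f :: "real^2 \<Rightarrow> 'b::euclidean_space" and h :: "real^2 \<Rightarrow> 'c::euclidean_space"
  assumes "f \<in> L2_space S" "h \<in> L2_space S" "0 \<le> c" and le: "\<And>x. norm (f x) \<le> c * norm (h x)"
  shows "L2_norm S f \<le> c * L2_norm S h"
proof (rule power2_le_imp_le)
  have "(norm (f x))\<^sup>2 \<le> c\<^sup>2 * (norm (h x))\<^sup>2" for x
    using power_mono[OF le[of x], of 2] by (simp add: power_mult_distrib)
  then have "(LINT x|lebesgue_on S. (norm (f x))\<^sup>2) \<le> (LINT x|lebesgue_on S. c\<^sup>2 * (norm (h x))\<^sup>2)"
    using Bochner_Integration.integral_mono[OF L2_spaceD(2)[OF assms(1)]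
        integrable_mult_right[OF L2_spaceD(2)[OF assms(2)]]] by simp
  then show "(L2_norm S f)\<^sup>2 \<le> (c * L2_norm S h)\<^sup>2"
    by (simp add: L2_norm_square power_mult_distrib)
qed (simp add: assms L2_norm_nonneg)

lemma L2_norm_cong: "(\<And>x. x \<in> S \<Longrightarrow> f x = h x) \<Longrightarrow> L2_norm S f = L2_norm S h"
  unfolding L2_norm_def
  by (intro arg_cong[of _ _ sqrt] Bochner_Integration.integral_cong) (auto simp: space_restrict_space)

lemma L2_space_cong: "(\<And>x. x \<in> S \<Longrightarrow> f x = h x) \<Longrightarrow> f \<in> L2_space S \<longleftrightarrow> h \<in> L2_space S"
  unfolding L2_space_def mem_Collect_eq
  by (intro arg_cong2[of _ _ _ _ conj] measurable_cong Bochner_Integration.integrable_cong)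
     (auto simp: space_restrict_space)

text \<open>Lebesgue measure is complete. This is what makes the strain of a piecewise polynomial
function measurable, although its value on the edges is arbitrary.\<close>

lemma borel_measurable_AE_on:
  fixes f h :: "real^2 \<Rightarrow> 'b::euclidean_space"
  assumes "S \<in> sets lebesgue" "f \<in> borel_measurable (lebesgue_on S)" "AE x in lebesgue_on S. f x = h x"
  shows "h \<in> borel_measurable (lebesgue_on S)"
proof -
  have "AE x in lebesgue. x \<in> S \<longrightarrow> f x = h x"
    using assms(3) AE_restrict_space_iff[of S lebesgue] assms(1) by simp
  then have ae: "AE x in lebesgue. (if x \<in> S then f x else 0) = (if x \<in> S then h x else 0)"
    by (rule eventually_mono) simp
  have "(\<lambda>x. if x \<in> S then f x else 0) \<in> borel_measurable lebesgue"
    using borel_measurable_if_I[OF assms(2,1)] .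
  from borel_measurable_AE[OF this ae] show ?thesis
    by (rule borel_measurable_if_D)
qed

lemma L2_norm_cong_AE:
  fixes f h :: "real^2 \<Rightarrow> 'b::euclidean_space"
  assumes "S \<in> sets lebesgue" "f \<in> borel_measurable (lebesgue_on S)" "AE x in lebesgue_on S. f x = h x"
  shows "L2_norm S f = L2_norm S h"
proof -
  have h: "h \<in> borel_measurable (lebesgue_on S)"
    using borel_measurable_AE_on[OF assms] .
  have "(\<lambda>x. (norm (f x))\<^sup>2) \<in> borel_measurable (lebesgue_on S)" "(\<lambda>x. (norm (h x))\<^sup>2) \<in> borel_measurable (lebesgue_on S)"
    using h assms(2) by measurable
  moreover have "AE x in lebesgue_on S. (norm (f x))\<^sup>2 = (norm (h x))\<^sup>2"
    using assms(3) by eventually_elim simp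
  ultimately show ?thesis
    unfolding L2_norm_def by (intro arg_cong[of _ _ sqrt] integral_cong_AE)
qed

section \<open>Integration by parts for compactly supported functions\<close>

lemma integrable_bounded_support:
  fixes u :: "real^2 \<Rightarrow> real"
  assumes "u \<in> borel_measurable borel" "\<And>x. \<bar>u x\<bar> \<le> M * indicator (cball 0 R) x"
  shows "integrable lborel u"
proof (rule Bochner_Integration.integrable_bound)
  show "integrable lborel (\<lambda>x::real^2. M * indicator (cball 0 R) x)"
    using emeasure_lborel_cball_finite by (intro integrable_mult_right integrable_real_indicator) auto
  show "AE x in lborel. norm (u x) \<le> norm (M * indicator (cball 0 R) x)"
    using assms(2) by (intro AE_I2) (smt (verit) real_norm_def)
qed (use assms in auto)

text \<open>The integral of \<open>u (x + h e)\<close> over the plane does not depend on \<open>h\<close>, so every difference quotient of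
\<open>u\<close> has integral zero. The difference quotients are bounded by the maximum of the derivative and
supported in a fixed ball, so by dominated convergence the integral of the derivative is their
limit.\<close>

lemma integral_partial_deriv_eq_0:
  fixes u :: "real^2 \<Rightarrow> real"
  assumes u: "C_k 1 u" and K: "compact K" and supp: "\<And>x. x \<notin> K \<Longrightarrow> u x = 0"
  shows "(LINT x|lborel. partial_deriv j u x) = 0"
proof -
  define e where "e = (axis j 1 :: real^2)"
  have du: "\<And>x. u differentiable (at x)" and cd: "continuous_on UNIV (partial_deriv j u)"
    using u by auto
  have cu: "continuous_on UNIV u" using C_k_imp_continuous[OF u] .
  have supp': "partial_deriv j u x = 0" if "x \<notin> K" for x
    using partial_deriv_outside[OF compact_imp_closed[OF K] that] supp by blast
  obtain R where R: "K \<subseteq> cball 0 R" 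
    using compact_imp_bounded[OF K] by (force simp: bounded_iff)
  obtain M0 where M0: "\<And>x. x \<in> K \<Longrightarrow> \<bar>partial_deriv j u x\<bar> \<le> M0"
    using compact_imp_bounded[OF compact_continuous_image[OF continuous_on_subset[OF cd subset_UNIV] K]]
    unfolding bounded_iff by auto
  define M where "M = max M0 0"
  have M: "\<bar>partial_deriv j u x\<bar> \<le> M" for x
    using M0[of x] supp'[of x] by (cases "x \<in> K") (auto simp: M_def)
  obtain N0 where N0: "\<And>x. x \<in> K \<Longrightarrow> \<bar>u x\<bar> \<le> N0"
    using compact_imp_bounded[OF compact_continuous_image[OF continuous_on_subset[OF cu subset_UNIV] K]]
    unfolding bounded_iff by auto
  have N: "\<bar>u x\<bar> \<le> max N0 0 * indicator (cball 0 R) x" for x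
    using N0[of x] supp[of x] R by (cases "x \<in> K") (auto simp: indicator_def)
  have mu: "u \<in> borel_measurable borel"
    using cu by (rule borel_measurable_continuous_onI)
  have int_u: "integrable lborel u"
    using integrable_bounded_support[OF mu N] .
  (* Steps at most 1 keep all difference quotients supported in one ball. *)
  define h where "h n = inverse (real (Suc n))" for n
  have h: "h n > 0" "h n \<le> 1" for n
    by (simp_all add: h_def inverse_le_1_iff)
  define q where "q n x = (u (h n *\<^sub>R e + x) - u x) / h n" for n x
  have mq: "q n \<in> borel_measurable borel" for n
    unfolding q_def by (intro borel_measurable_divide borel_measurable_diff measurable_compose[OF _ mu] mu) auto
  have int_shift: "integrable lborel (\<lambda>x. u (c + x))" "(LINT x|lborel. u (c + x)) = (LINT x|lborel. u x)" for c
  proof -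
    have "integrable (distr lborel borel ((+) c)) u" using int_u lborel_distr_plus by metis
    then show "integrable lborel (\<lambda>x. u (c + x))"
      using mu by (subst (asm) integrable_distr_eq) auto
    show "(LINT x|lborel. u (c + x)) = (LINT x|lborel. u x)"
      using integral_distr[of "(+) c" lborel borel u] mu lborel_distr_plus[of c] by simp
  qed
  have q0: "(LINT x|lborel. q n x) = 0" for n
    unfolding q_def using int_shift int_u by simp
  have "(\<lambda>n. LINT x|lborel. q n x) \<longlonglongrightarrow> (LINT x|lborel. partial_deriv j u x)"
  proof (rule integral_dominated_convergence)
    show "integrable lborel (\<lambda>x::real^2. M * indicator (cball 0 (R + 1)) x)"
      using emeasure_lborel_cball_finite by (intro integrable_mult_right integrable_real_indicator) auto
    show "AE x in lborel. (\<lambda>n. q n x) \<longlonglongrightarrow> partial_deriv j u x"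
    proof (rule AE_I2)
      fix x
      have "((\<lambda>t. u (x + t *\<^sub>R e)) has_real_derivative partial_deriv j u x) (at 0)"
        using has_real_derivative_along_axis[OF du, of x j 0] by (simp add: e_def)
      then have lim: "((\<lambda>t. (u (x + t *\<^sub>R e) - u x) / t) \<longlongrightarrow> partial_deriv j u x) (at 0)"
        by (simp add: has_field_derivative_iff)
      have "h \<longlonglongrightarrow> 0" unfolding h_def using LIMSEQ_inverse_real_of_nat .
      then have "filterlim h (at 0) sequentially"
        using h(1) by (intro filterlim_atI) (auto intro!: always_eventually simp: less_imp_neq[symmetric])
      from filterlim_compose[OF lim this]
      show "(\<lambda>n. q n x) \<longlonglongrightarrow> partial_deriv j u x" by (simp add: q_def add.commute)
    qed
    show "AE x in lborel. norm (q n x) \<le> M * indicator (cball 0 (R + 1)) x" for n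
    proof (rule AE_I2)
      fix x
      show "norm (q n x) \<le> M * indicator (cball 0 (R + 1)) x"
      proof (cases "x \<in> cball 0 (R + 1)")
        case False
        (* The step is at most 1, so neither x nor its translate lies in K. *)
        have "norm x \<le> norm (h n *\<^sub>R e + x) + norm (h n *\<^sub>R e)"
          by (metis add_diff_cancel_left' norm_triangle_ineq4 add.commute)
        moreover have "norm (h n *\<^sub>R e) \<le> 1" using h by (simp add: e_def less_imp_le)
        ultimately have "x \<notin> K" "h n *\<^sub>R e + x \<notin> K"
          using False R by (auto simp: subset_iff)
        then have "q n x = 0" using supp by (simp add: q_def)
        then show ?thesis by (simp add: M_def)
      next
        case True
        have "\<exists>s>0. s < h n \<and> u (x + h n *\<^sub>R e) - u (x + 0 *\<^sub>R e) = (h n - 0) * partial_deriv j u (x + s *\<^sub>R e)"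
          unfolding e_def using h by (intro MVT2 has_real_derivative_along_axis du)
        then obtain s where "u (x + h n *\<^sub>R e) - u x = h n * partial_deriv j u (x + s *\<^sub>R e)" by auto
        then have "q n x = partial_deriv j u (x + s *\<^sub>R e)"
          using h(1)[of n] by (simp add: q_def add.commute)
        then show ?thesis using M True by simp
      qed
    qed
  qed (use mq cd in \<open>auto intro: borel_measurable_continuous_onI\<close>)
  then show ?thesis by (simp add: q0 LIMSEQ_const_iff)
qed

lemma integral_partial_deriv_eq_0_on:
  fixes u :: "real^2 \<Rightarrow> real"
  assumes "C_k 1 u" "compact K" "K \<subseteq> S" "open S" and supp: "\<And>x. x \<notin> K \<Longrightarrow> u x = 0"
  shows "(LINT x|lebesgue_on S. partial_deriv j u x) = 0"
proof -
  have "partial_deriv j u x = 0" if "x \<notin> S" for x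
    using partial_deriv_outside[OF compact_imp_closed[OF assms(2)], of x u] supp that assms(3) by blast
  then have "(\<lambda>x. if x \<in> S then partial_deriv j u x else 0) = partial_deriv j u"
    by auto
  then have "(LINT x|lebesgue_on S. partial_deriv j u x) = (LINT x|lebesgue. partial_deriv j u x)"
    using Lebesgue_Measure.integral_restrict_UNIV[of S "partial_deriv j u"] assms(4) by simp
  also have "\<dots> = (LINT x|lborel. partial_deriv j u x)"
    using assms(1) by (intro integral_completion) (auto intro: borel_measurable_continuous_onI)
  finally show ?thesis using integral_partial_deriv_eq_0[OF assms(1,2) supp] by simp
qed

section \<open>Inequalities of Poincare and Korn for test functions\<close>

lemma C_k_mono: "C_k k f \<Longrightarrow> l \<le> k \<Longrightarrow> C_k l f"
proof (induction k)
  case (Suc k)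
  then show ?case using C_k_SucD by (cases "l = Suc k") auto
qed simp

lemma grad_nth: "grad f x $ j = partial_deriv j f x"
  by (simp add: grad_def)

lemma grad_nth_nth:
  assumes "f differentiable (at x)"
  shows "grad f x $ j $ i = partial_deriv j (\<lambda>x. f x $ i) x"
  using partial_deriv_linear[OF bounded_linear_vec_nth assms] by (simp add: grad_nth)

lemma continuous_on_grad: "C_k 1 f \<Longrightarrow> continuous_on S (grad f)"
  unfolding grad_def by (auto intro!: continuous_on_vec_lambda intro: continuous_on_subset)

lemma continuous_imp_integrable_on:
  fixes f :: "real^2 \<Rightarrow> real"
  assumes "open S" "bounded S" "continuous_on UNIV f"
  shows "integrable (lebesgue_on S) f"
  using L2_space_integrable_inner[OF continuous_in_L2_space[OF assms]
      continuous_in_L2_space[OF assms(1,2) continuous_on_const[of UNIV "1::real"]]] by simp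

lemma C_k_coordinate: "C_k k (\<lambda>x::real^2. x $ i)"
  by (intro polynomial_function_imp_C_k polynomial_function_bounded_linear bounded_linear_vec_nth)

text \<open>The derivative of \<open>x\<^sub>1 |\<phi>|\<^sup>2\<close> in direction 1 is \<open>|\<phi>|\<^sup>2 + 2 x\<^sub>1 \<phi> \<bullet> \<partial>\<^sub>1 \<phi>\<close> and has integral zero, while the
second term is at most \<open>|\<phi>|\<^sup>2 / 2 + 2 R\<^sup>2 |\<partial>\<^sub>1 \<phi>|\<^sup>2\<close> in absolute value.\<close>

lemma Poincare_test_function:
  fixes \<phi> :: "real^2 \<Rightarrow> 'b::euclidean_space"
  assumes S: "open S" "S \<subseteq> cball 0 R" and "R \<ge> 0"
    and \<phi>: "C_k 1 \<phi>" and K: "compact K" "K \<subseteq> S" "\<And>x. x \<notin> K \<Longrightarrow> \<phi> x = 0"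
  shows "L2_norm S \<phi> \<le> 2 * R * L2_norm S (grad \<phi>)"
proof -
  have bS: "bounded S" using S(2) bounded_cball bounded_subset by blast
  note L2 = continuous_in_L2_space[OF S(1) bS]
  have p: "\<phi> \<in> L2_space S" using C_k_imp_continuous[OF \<phi>] by (rule L2)
  have gp: "grad \<phi> \<in> L2_space S" using continuous_on_grad[OF \<phi>] by (rule L2)
  define q where "q x = \<phi> x \<bullet> \<phi> x" for x
  define u where "u x = x $ 1 * q x" for x
  have Cq: "C_k 1 q" unfolding q_def using C_1_bilinear[OF bounded_bilinear_inner \<phi> \<phi>] .
  have Cu: "C_k 1 u" unfolding u_def using C_1_bilinear[OF bounded_bilinear_mult C_k_coordinate Cq] .
  have dq: "partial_deriv 1 q x = 2 * (\<phi> x \<bullet> partial_deriv 1 \<phi> x)" for x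
    using partial_deriv_bilinear[OF bounded_bilinear_inner, of \<phi> x \<phi> 1] \<phi> by (simp add: q_def[abs_def] inner_commute)
  have dx: "partial_deriv 1 (\<lambda>x::real^2. x $ 1) x = 1" for x
    by (subst partial_deriv_eqI[OF bounded_linear_imp_has_derivative[OF bounded_linear_vec_nth]]) (simp add: axis_def)
  have du: "partial_deriv 1 u x = q x + 2 * (x $ 1) * (\<phi> x \<bullet> partial_deriv 1 \<phi> x)" for x
  proof -
    have "(\<lambda>x::real^2. x $ 1) differentiable (at x)" "q differentiable (at x)"
      using C_k_coordinate[of 1 1] Cq by auto
    from partial_deriv_bilinear[OF bounded_bilinear_mult this, of 1] show ?thesis
      by (simp add: u_def[abs_def] dx dq)
  qed
  have "(norm (\<phi> x))\<^sup>2 - 4 * R\<^sup>2 * (norm (grad \<phi> x))\<^sup>2 \<le> 2 * partial_deriv 1 u x" if "x \<in> S" for x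
  proof -
    have "\<bar>x $ 1\<bar> \<le> R" using component_le_norm_cart[of x 1] S(2) that by auto
    then have "\<bar>x $ 1 * (\<phi> x \<bullet> partial_deriv 1 \<phi> x)\<bar> \<le> R * (norm (\<phi> x) * norm (partial_deriv 1 \<phi> x))"
      unfolding abs_mult using Cauchy_Schwarz_ineq2 \<open>R \<ge> 0\<close> by (intro mult_mono) auto
    also have "\<dots> \<le> R * (norm (\<phi> x) * norm (grad \<phi> x))"
      using Finite_Cartesian_Product.norm_nth_le[of "grad \<phi> x" 1] \<open>R \<ge> 0\<close> by (intro mult_left_mono) (auto simp: grad_nth)
    finally have "4 * \<bar>x $ 1 * (\<phi> x \<bullet> partial_deriv 1 \<phi> x)\<bar> \<le> 2 * norm (\<phi> x) * (2 * R * norm (grad \<phi> x))" by (simp add: ac_simps)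
    also have "\<dots> \<le> (norm (\<phi> x))\<^sup>2 + (2 * R * norm (grad \<phi> x))\<^sup>2"
      by (rule sum_squares_bound)
    finally show ?thesis by (simp add: du q_def power2_norm_eq_inner[of "\<phi> x"] power_mult_distrib)
  qed
  moreover have "(LINT x|lebesgue_on S. 2 * partial_deriv 1 u x) = 0"
    using integral_partial_deriv_eq_0_on[OF Cu K(1,2) S(1), of 1] K(3) by (simp add: u_def q_def)
  moreover have "integrable (lebesgue_on S) (\<lambda>x. 2 * partial_deriv 1 u x)"
    using continuous_imp_integrable_on[OF S(1) bS] Cu by simp
  moreover have "integrable (lebesgue_on S) (\<lambda>x. (norm (\<phi> x))\<^sup>2 - 4 * R\<^sup>2 * (norm (grad \<phi> x))\<^sup>2)"
    using L2_spaceD(2)[OF p] L2_spaceD(2)[OF gp] by simp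
  ultimately have "(LINT x|lebesgue_on S. (norm (\<phi> x))\<^sup>2 - 4 * R\<^sup>2 * (norm (grad \<phi> x))\<^sup>2) \<le> 0"
    using Bochner_Integration.integral_mono[of "lebesgue_on S" "\<lambda>x. (norm (\<phi> x))\<^sup>2 - 4 * R\<^sup>2 * (norm (grad \<phi> x))\<^sup>2"
        "\<lambda>x. 2 * partial_deriv 1 u x"] by (simp add: space_restrict_space)
  then have "(L2_norm S \<phi>)\<^sup>2 \<le> (2 * R * L2_norm S (grad \<phi>))\<^sup>2"
    using L2_spaceD(2)[OF p] L2_spaceD(2)[OF gp] by (simp add: L2_norm_square power_mult_distrib)
  then show ?thesis
    by (rule power2_le_imp_le) (simp add: L2_norm_nonneg \<open>R \<ge> 0\<close>)
qed

definition sym_part :: "real^2^2 \<Rightarrow> real^2^2" where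
  "sym_part A = (1/2) *\<^sub>R (A + transpose A)"

lemma strain_eq_sym: "strain v x = sym_part (grad v x)"
  by (simp add: strain_def sym_part_def)

lemma bounded_linear_sym: "bounded_linear sym_part"
  unfolding linear_conv_bounded_linear[symmetric]
  by (rule linearI) (auto simp: sym_part_def transpose_def vec_eq_iff algebra_simps)

text \<open>The algebra behind Korn's inequality. The trace enters with a favourable sign, and for a gradient
the determinant is a null Lagrangian, that is, a divergence.\<close>

lemma norm_square_sym:
  "(norm A)\<^sup>2 = 2 * (norm (sym_part A))\<^sup>2 - (A $ 1 $ 1 + A $ 2 $ 2)\<^sup>2 + 2 * (A $ 1 $ 1 * A $ 2 $ 2 - A $ 1 $ 2 * A $ 2 $ 1)"
  unfolding power2_norm_eq_inner
  by (simp add: inner_vec_def sum_2 sym_part_def transpose_def) (simp add: field_simps power2_eq_square)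

text \<open>The determinant of the gradient of \<open>\<phi> = (a, b)\<close> is the divergence
\<open>\<partial>\<^sub>1 (a \<partial>\<^sub>2 b) - \<partial>\<^sub>2 (a \<partial>\<^sub>1 b)\<close>, the terms with second derivatives of \<open>b\<close> cancelling by symmetry. Its
integral therefore vanishes.\<close>

lemma Korn_test_function:
  fixes \<phi> :: "real^2 \<Rightarrow> real^2"
  assumes S: "open S" "bounded S"
    and \<phi>: "C_k 2 \<phi>" and K: "compact K" "K \<subseteq> S" "\<And>x. x \<notin> K \<Longrightarrow> \<phi> x = 0"
  shows "L2_norm S (grad \<phi>) \<le> sqrt 2 * L2_norm S (\<lambda>x. sym_part (grad \<phi> x))"
proof -
  have \<phi>1: "C_k 1 \<phi>" by (rule C_k_mono[OF \<phi>]) simp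
  have gp: "grad \<phi> \<in> L2_space S"
    using continuous_in_L2_space[OF S continuous_on_grad[OF \<phi>1]] .
  have sp: "(\<lambda>x. sym_part (grad \<phi> x)) \<in> L2_space S"
    using L2_space_linear[OF gp bounded_linear_sym] .
  define a where "a x = \<phi> x $ 1" for x
  define b where "b x = \<phi> x $ 2" for x
  have a: "C_k 1 a" unfolding a_def using C_k_linear[OF bounded_linear_vec_nth \<phi>1] .
  have b: "C_k 2 b" unfolding b_def using C_k_linear[OF bounded_linear_vec_nth \<phi>] .
  have db: "C_k 1 (partial_deriv j b)" for j using b by (simp add: numeral_2_eq_2)
  define u where "u j x = a x * partial_deriv j b x" for j x
  have Cu: "C_k 1 (u j)" for j
    unfolding u_def using C_1_bilinear[OF bounded_bilinear_mult a db] .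
  have du: "partial_deriv i (u j) x = partial_deriv i a x * partial_deriv j b x + a x * partial_deriv i (partial_deriv j b) x" for i j x
  proof -
    have "a differentiable (at x)" "partial_deriv j b differentiable (at x)" using a db[of j] by auto
    from partial_deriv_bilinear[OF bounded_bilinear_mult this, of i] show ?thesis
      by (simp add: u_def[abs_def])
  qed
  have int0: "(LINT x|lebesgue_on S. partial_deriv i (u j) x) = 0" for i j
    using integral_partial_deriv_eq_0_on[OF Cu K(1,2) S(1)] K(3) by (simp add: u_def a_def)
  have int: "integrable (lebesgue_on S) (partial_deriv i (u j))" for i j
    using continuous_imp_integrable_on[OF S] Cu[of j] by simp
  have "(norm (grad \<phi> x))\<^sup>2 \<le> 2 * (norm (sym_part (grad \<phi> x)))\<^sup>2 + 2 * (partial_deriv 1 (u 2) x - partial_deriv 2 (u 1) x)" for x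
  proof -
    have "\<phi> differentiable (at x)" using \<phi>1 by simp
    then have "grad \<phi> x $ j $ 1 = partial_deriv j a x" "grad \<phi> x $ j $ 2 = partial_deriv j b x" for j
      by (simp_all add: grad_nth_nth a_def[abs_def] b_def[abs_def])
    then show ?thesis
      by (subst norm_square_sym) (simp add: du partial_deriv_commute[OF b, of 2 1] algebra_simps)
  qed
  then have "(LINT x|lebesgue_on S. (norm (grad \<phi> x))\<^sup>2) \<le>
      (LINT x|lebesgue_on S. 2 * (norm (sym_part (grad \<phi> x)))\<^sup>2 + 2 * (partial_deriv 1 (u 2) x - partial_deriv 2 (u 1) x))"
    using L2_spaceD(2)[OF gp] L2_spaceD(2)[OF sp] int by (intro Bochner_Integration.integral_mono) auto
  also have "\<dots> = 2 * (LINT x|lebesgue_on S. (norm (sym_part (grad \<phi> x)))\<^sup>2)"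
    using L2_spaceD(2)[OF sp] int int0 by simp
  finally have "(L2_norm S (grad \<phi>))\<^sup>2 \<le> (sqrt 2 * L2_norm S (\<lambda>x. sym_part (grad \<phi> x)))\<^sup>2"
    by (simp add: L2_norm_square power_mult_distrib)
  then show ?thesis
    by (rule power2_le_imp_le) (simp add: L2_norm_nonneg)
qed

section \<open>Identification of the weak gradient\<close>

lemma has_derivative_max_square: "((\<lambda>s::real. (max 0 s)\<^sup>2) has_real_derivative 2 * max 0 s) (at s)"
proof -
  consider "s > 0" | "s < 0" | "s = 0" by linarith
  then show ?thesis
  proof cases
    case 1
    have "((\<lambda>s::real. s\<^sup>2) has_real_derivative 2 * max 0 s) (at s)"
      using 1 by (auto intro!: derivative_eq_intros)
    then show ?thesis
      by (rule DERIV_cong_ev[THEN iffD1, rotated -1])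
         (use 1 in \<open>auto intro!: eventually_mono[OF eventually_nhds_in_open[of "{0<..}"]]\<close>)
  next
    case 2
    have "((\<lambda>s::real. 0) has_real_derivative 2 * max 0 s) (at s)"
      using 2 by simp
    then show ?thesis
      by (rule DERIV_cong_ev[THEN iffD1, rotated -1])
         (use 2 in \<open>auto intro!: eventually_mono[OF eventually_nhds_in_open[of "{..<0}"]]\<close>)
  next
    case 3
    have "((\<lambda>h::real. (max 0 h)\<^sup>2 / h) \<longlongrightarrow> 0) (at 0)"
    proof (rule Lim_null_comparison)
      show "\<forall>\<^sub>F h in at 0. norm ((max 0 h)\<^sup>2 / h) \<le> \<bar>h::real\<bar>"
        by (auto intro!: always_eventually simp: max_def power2_eq_square)
      show "((\<lambda>h::real. \<bar>h\<bar>) \<longlongrightarrow> 0) (at 0)" by (intro tendsto_rabs_zero tendsto_ident_at)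
    qed
    then show ?thesis using 3 by (simp add: has_field_derivative_iff)
  qed
qed

text \<open>For \<open>r > 0\<close>, a \<open>C\<^sup>1\<close> weight that is positive exactly on the ball of radius \<open>r\<close> about \<open>c\<close>. Squaring
the positive part makes the derivative continuous across the sphere.\<close>

definition cutoff :: "real^2 \<Rightarrow> real \<Rightarrow> real^2 \<Rightarrow> real" where
  "cutoff c r x = (max 0 (r\<^sup>2 - (x - c) \<bullet> (x - c)))\<^sup>2"

lemma partial_deriv_cutoff:
  "partial_deriv j (cutoff c r) x = - 4 * max 0 (r\<^sup>2 - (x - c) \<bullet> (x - c)) * ((x - c) $ j)"
  "cutoff c r differentiable (at x)"
proof -
  have "((\<lambda>x. r\<^sup>2 - (x - c) \<bullet> (x - c)) has_derivative (\<lambda>h. - 2 * ((x - c) \<bullet> h))) (at x)"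
    by (auto intro!: derivative_eq_intros simp: inner_commute)
  from DERIV_compose_FDERIV[OF has_derivative_max_square this]
  have d: "(cutoff c r has_derivative (\<lambda>h. - 2 * ((x - c) \<bullet> h) * (2 * max 0 (r\<^sup>2 - (x - c) \<bullet> (x - c))))) (at x)"
    by (simp add: cutoff_def[abs_def])
  show "partial_deriv j (cutoff c r) x = - 4 * max 0 (r\<^sup>2 - (x - c) \<bullet> (x - c)) * ((x - c) $ j)"
    by (subst partial_deriv_eqI[OF d]) (simp add: inner_axis algebra_simps)
  show "cutoff c r differentiable (at x)" using d unfolding differentiable_def by blast
qed

lemma C_1_cutoff: "C_k 1 (cutoff c r)"
proof -
  have "partial_deriv j (cutoff c r) = (\<lambda>x. - 4 * max 0 (r\<^sup>2 - (x - c) \<bullet> (x - c)) * ((x - c) $ j))" for j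
    using partial_deriv_cutoff(1) by blast
  then show ?thesis
    using partial_deriv_cutoff(2) by (auto intro!: continuous_intros)
qed

lemma cutoff_pos: "x \<in> ball c r \<Longrightarrow> 0 < cutoff c r x"
proof -
  assume "x \<in> ball c r"
  then have "norm (x - c) < r" by (simp add: dist_norm norm_minus_commute)
  then have "(norm (x - c))\<^sup>2 < r\<^sup>2" by (intro power_strict_mono) auto
  then show ?thesis by (simp add: cutoff_def power2_norm_eq_inner)
qed

lemma cutoff_outside: 
  assumes "0 < r" "x \<notin> ball c r"
  shows "cutoff c r x = 0" "partial_deriv j (cutoff c r) x = 0"
proof -
  have "r \<le> norm (x - c)" using assms(2) by (simp add: dist_norm norm_minus_commute)
  then have "r\<^sup>2 \<le> (norm (x - c))\<^sup>2" using assms(1) by (intro power_mono) auto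
  then have "max 0 (r\<^sup>2 - (x - c) \<bullet> (x - c)) = 0" by (simp add: power2_norm_eq_inner)
  then show "cutoff c r x = 0" "partial_deriv j (cutoff c r) x = 0"
    by (simp_all add: cutoff_def partial_deriv_cutoff)
qed

lemma cutoff_bounds: "0 \<le> cutoff c r x" "cutoff c r x \<le> r^4"
proof -
  have "max 0 (r\<^sup>2 - (x - c) \<bullet> (x - c)) \<le> r\<^sup>2" by simp
  then have "(max 0 (r\<^sup>2 - (x - c) \<bullet> (x - c)))\<^sup>2 \<le> (r\<^sup>2)\<^sup>2" by (intro power_mono) auto
  then show "cutoff c r x \<le> r^4" by (simp add: cutoff_def)
qed (simp add: cutoff_def)

text \<open>With \<open>\<eta>\<close> the cutoff of the ball, integration by parts gives
\<open>\<integral> \<partial>\<^sub>j (\<phi>\<^sub>n - w) \<bullet> \<eta> \<partial>\<^sub>j (\<phi>\<^sub>m - w) = - \<integral> (\<phi>\<^sub>n - w) \<bullet> \<partial>\<^sub>j (\<eta> \<partial>\<^sub>j (\<phi>\<^sub>m - w))\<close>. Second derivatives of \<open>\<phi>\<^sub>m\<close>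
are not bounded as \<open>m\<close> grows, but for fixed \<open>m\<close> the right-hand side tends to zero as \<open>n\<close> grows, since
\<open>v = w\<close> on the ball. Letting \<open>m\<close> grow afterwards leaves \<open>\<integral> \<eta> |g\<^sub>j - \<partial>\<^sub>j w|\<^sup>2 = 0\<close>. Thus the approximants
themselves serve as test functions.\<close>

lemma H1_limit_gradient_on_ball:
  fixes v w :: "real^2 \<Rightarrow> 'b::euclidean_space"
  assumes S: "open S" "bounded S"
    and v: "v \<in> L2_space S" and g: "g \<in> L2_space S"
    and \<phi>: "\<And>n. C_k 2 (\<phi> n)"
    and lim_v: "(\<lambda>n. L2_norm S (\<lambda>x. \<phi> n x - v x)) \<longlonglongrightarrow> 0"
    and lim_g: "(\<lambda>n. L2_norm S (\<lambda>x. grad (\<phi> n) x - g x)) \<longlonglongrightarrow> 0"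
    and w: "C_k 2 w" and r: "0 < r" "cball c r \<subseteq> S" and vw: "\<And>x. x \<in> ball c r \<Longrightarrow> v x = w x"
  shows "AE x in lebesgue_on S. x \<in> ball c r \<longrightarrow> g x $ j = partial_deriv j w x"
proof -
  note L2 = continuous_in_L2_space[OF S]
  define \<eta> where "\<eta> = cutoff c r"
  have \<eta>1: "C_k 1 \<eta>" unfolding \<eta>_def by (rule C_1_cutoff)
  have w1: "C_k 1 w" by (rule C_k_mono[OF w]) simp
  have \<phi>1: "C_k 1 (\<phi> n)" for n by (rule C_k_mono[OF \<phi>]) simp
  define f where "f x = g x $ j - partial_deriv j w x" for x
  define D where "D n x = partial_deriv j (\<phi> n) x - partial_deriv j w x" for n x
  have D1: "C_k 1 (D n)" for n
    unfolding D_def using \<phi>[of n] w by (intro C_k_diff) (simp_all add: numeral_2_eq_2)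
  have D2: "D n \<in> L2_space S" for n
    using C_k_imp_continuous[OF D1] by (rule L2)
  have wj: "partial_deriv j w \<in> L2_space S" by (rule L2) (use w1 in simp)
  have f2: "f \<in> L2_space S"
    unfolding f_def using L2_space_diff[OF L2_space_linear[OF g bounded_linear_vec_nth] wj] .
  have lim_D: "(\<lambda>n. L2_norm S (\<lambda>x. D n x - f x)) \<longlonglongrightarrow> 0"
    using L2_norm_linear_tendsto[OF L2[OF continuous_on_grad[OF \<phi>1]] g bounded_linear_vec_nth[of j] lim_g]
    by (simp add: D_def f_def grad_nth)
  define z where "z n x = \<phi> n x - w x" for n x
  have z1: "C_k 1 (z n)" for n unfolding z_def by (intro C_k_diff \<phi>1 w1)
  have z2: "z n \<in> L2_space S" for n using C_k_imp_continuous[OF z1] by (rule L2)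
  have vw2: "(\<lambda>x. v x - w x) \<in> L2_space S"
    using L2_space_diff[OF v L2[OF C_k_imp_continuous[OF w1]]] .
  have lim_z: "(\<lambda>n. L2_norm S (\<lambda>x. z n x - (v x - w x))) \<longlonglongrightarrow> 0"
    using lim_v by (simp add: z_def)
  define \<psi> where "\<psi> m x = \<eta> x *\<^sub>R D m x" for m x
  have \<psi>1: "C_k 1 (\<psi> m)" for m
    unfolding \<psi>_def using C_1_bilinear[OF bounded_bilinear_scaleR \<eta>1 D1] .
  have \<psi>2: "\<psi> m \<in> L2_space S" for m using C_k_imp_continuous[OF \<psi>1] by (rule L2)
  have d\<psi>2: "partial_deriv j (\<psi> m) \<in> L2_space S" for m
    by (rule L2) (use \<psi>1[of m] in simp)
  have d\<psi>0: "partial_deriv j (\<psi> m) x = 0" if "x \<notin> ball c r" for m x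
  proof -
    have "\<eta> differentiable (at x)" "D m differentiable (at x)" using \<eta>1 D1[of m] by auto
    from partial_deriv_bilinear[OF bounded_bilinear_scaleR this, of j] show ?thesis
      using cutoff_outside[OF r(1) that] by (simp add: \<psi>_def[abs_def] \<eta>_def)
  qed
  have parts: "(LINT x|lebesgue_on S. D n x \<bullet> \<psi> m x) = - (LINT x|lebesgue_on S. z n x \<bullet> partial_deriv j (\<psi> m) x)" for n m
  proof -
    define u where "u x = z n x \<bullet> \<psi> m x" for x
    have u1: "C_k 1 u" unfolding u_def using C_1_bilinear[OF bounded_bilinear_inner z1 \<psi>1] .
    have "u x = 0" if "x \<notin> cball c r" for x
      using cutoff_outside(1)[OF r(1), of x c] that by (simp add: u_def \<psi>_def \<eta>_def)
    then have "(LINT x|lebesgue_on S. partial_deriv j u x) = 0"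
      using integral_partial_deriv_eq_0_on[OF u1 compact_cball r(2) S(1)] by blast
    moreover have "partial_deriv j u x = D n x \<bullet> \<psi> m x + z n x \<bullet> partial_deriv j (\<psi> m) x" for x
    proof -
      have "z n differentiable (at x)" "\<psi> m differentiable (at x)" using z1[of n] \<psi>1[of m] by auto
      moreover have "partial_deriv j (z n) x = D n x"
        unfolding z_def D_def using \<phi>1[of n] w1 by (intro partial_deriv_diff) auto
      ultimately show ?thesis
        using partial_deriv_bilinear[OF bounded_bilinear_inner, of "z n" x "\<psi> m" j] by (simp add: u_def[abs_def])
    qed
    ultimately show ?thesis
      using L2_space_integrable_inner[OF D2 \<psi>2] L2_space_integrable_inner[OF z2 d\<psi>2] by simp
  qed
  (* The limit in n, for fixed m. *)
  have orth: "(LINT x|lebesgue_on S. f x \<bullet> \<psi> m x) = 0" for m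
  proof -
    have "(\<lambda>n. LINT x|lebesgue_on S. D n x \<bullet> \<psi> m x) \<longlonglongrightarrow> (LINT x|lebesgue_on S. f x \<bullet> \<psi> m x)"
      using L2_inner_tendsto[OF D2 f2 \<psi>2 lim_D] .
    moreover have "(\<lambda>n. LINT x|lebesgue_on S. D n x \<bullet> \<psi> m x) \<longlonglongrightarrow> - (LINT x|lebesgue_on S. (v x - w x) \<bullet> partial_deriv j (\<psi> m) x)"
      unfolding parts using tendsto_minus[OF L2_inner_tendsto[OF z2 vw2 d\<psi>2 lim_z]] .
    moreover have "(v x - w x) \<bullet> partial_deriv j (\<psi> m) x = 0" for x
      using vw[of x] d\<psi>0[of x m] by (cases "x \<in> ball c r") auto
    ultimately show ?thesis using LIMSEQ_unique by force
  qed
  (* The limit in m. The cutoff moves to the other factor, which then is a fixed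
     square-integrable function. *)
  define F where "F x = \<eta> x *\<^sub>R f x" for x
  have F2: "F \<in> L2_space S"
  proof (rule L2_spaceI_bound)
    have "\<eta> \<in> borel_measurable (lebesgue_on S)"
      using L2_spaceD(1)[OF L2[OF C_k_imp_continuous[OF \<eta>1]]] .
    then show "F \<in> borel_measurable (lebesgue_on S)"
      unfolding F_def using L2_spaceD(1)[OF f2] by (rule borel_measurable_scaleR)
    show "integrable (lebesgue_on S) (\<lambda>x. (r^4)\<^sup>2 * (norm (f x))\<^sup>2)"
      using L2_spaceD(2)[OF f2] by simp
    show "(norm (F x))\<^sup>2 \<le> (r^4)\<^sup>2 * (norm (f x))\<^sup>2" for x
      using power_mono[OF cutoff_bounds(2) cutoff_bounds(1), of c r x 2]
      by (simp add: F_def \<eta>_def power_mult_distrib mult_right_mono)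
  qed
  have "(LINT x|lebesgue_on S. D m x \<bullet> F x) = 0" for m
    using orth[of m] by (simp add: F_def \<psi>_def inner_commute)
  then have "(LINT x|lebesgue_on S. f x \<bullet> F x) = 0"
    using L2_inner_tendsto[OF D2 f2 F2 lim_D] by (simp add: LIMSEQ_const_iff)
  then have "AE x in lebesgue_on S. f x \<bullet> F x = 0"
    using integral_nonneg_eq_0_iff_AE[OF L2_space_integrable_inner[OF f2 F2]]
    by (simp add: F_def \<eta>_def cutoff_bounds)
  then show ?thesis
    by eventually_elim (use cutoff_pos in \<open>fastforce simp: F_def \<eta>_def f_def\<close>)
qed

text \<open>The exceptional set inside a piece is negligible near each of its points by the previous lemma,
hence negligible, as negligibility is a local property. The rest lies in the boundaries of finitely
many convex sets.\<close>

lemma H1_limit_gradient_AE: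
  fixes v :: "real^2 \<Rightarrow> 'b::euclidean_space"
  assumes S: "open S" "bounded S"
    and v: "v \<in> L2_space S" and g: "g \<in> L2_space S"
    and \<phi>: "\<And>n. C_k 2 (\<phi> n)"
    and lim_v: "(\<lambda>n. L2_norm S (\<lambda>x. \<phi> n x - v x)) \<longlonglongrightarrow> 0"
    and lim_g: "(\<lambda>n. L2_norm S (\<lambda>x. grad (\<phi> n) x - g x)) \<longlonglongrightarrow> 0"
    and \<T>: "finite \<T>" "\<And>T. T \<in> \<T> \<Longrightarrow> convex T" "S \<subseteq> \<Union>\<T>"
    and w: "\<And>T. T \<in> \<T> \<Longrightarrow> C_k 2 (w T)" "\<And>T x. T \<in> \<T> \<Longrightarrow> x \<in> T \<Longrightarrow> v x = w T x"
  shows "AE x in lebesgue_on S. g x = grad v x"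
proof -
  have Sm: "S \<in> sets lebesgue" using S by simp
  define Z where "Z T = {x \<in> S \<inter> interior T. g x \<noteq> grad v x}" for T
  have "negligible (Z T)" if T: "T \<in> \<T>" for T
    unfolding locally_negligible_alt[of "Z T"]
  proof
    fix x assume "x \<in> Z T"
    then have "x \<in> S \<inter> interior T" by (simp add: Z_def)
    then obtain r where r: "0 < r" "cball x r \<subseteq> S \<inter> interior T"
      using open_contains_cball[THEN iffD1, OF open_Int[OF S(1) open_interior]] by meson
    have "AE y in lebesgue_on S. y \<in> ball x r \<longrightarrow> g y $ j = partial_deriv j (w T) y" for j
      by (rule H1_limit_gradient_on_ball[OF S v g \<phi> lim_v lim_g w(1)[OF T] r(1)])
         (use r(2) w(2)[OF T] interior_subset[of T] ball_subset_cball[of x r] in blast)+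
    from this[of 1] this[of 2]
    have "AE y in lebesgue_on S. \<forall>j. y \<in> ball x r \<longrightarrow> g y $ j = partial_deriv j (w T) y"
      by eventually_elim (simp add: forall_2)
    then have "AE y in lebesgue. y \<in> S \<longrightarrow> (\<forall>j. y \<in> ball x r \<longrightarrow> g y $ j = partial_deriv j (w T) y)"
      using AE_restrict_space_iff[of S lebesgue] Sm by simp
    then have "AE y in lebesgue. y \<notin> Z T \<inter> ball x r"
    proof eventually_elim
      case (elim y)
      show ?case
      proof
        assume y: "y \<in> Z T \<inter> ball x r"
        then have "grad v y = grad (w T) y"
          using w(2)[OF T] interior_subset[of T] by (intro grad_cong_open[of "interior T"]) (auto simp: Z_def)
        moreover have "g y = grad (w T) y"
          using elim y by (auto simp: vec_eq_iff grad_nth Z_def)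
        ultimately show False using y by (simp add: Z_def)
      qed
    qed
    then have "negligible (Z T \<inter> ball x r)"
      unfolding negligible_iff_null_sets completion.AE_iff_null_sets by (simp add: Int_def)
    moreover have "openin (top_of_set (Z T)) (Z T \<inter> ball x r)" by (simp add: openin_open_Int)
    ultimately show "\<exists>U. openin (top_of_set (Z T)) U \<and> x \<in> U \<and> negligible U"
      using \<open>x \<in> Z T\<close> r(1) by (intro exI[of _ "Z T \<inter> ball x r"]) auto
  qed
  then have "negligible ((\<Union>T\<in>\<T>. Z T) \<union> (\<Union>T\<in>\<T>. frontier T))"
    using \<T>(1,2) negligible_convex_frontier by (intro negligible_Un negligible_Union) auto
  moreover have "{x \<in> S. g x \<noteq> grad v x} \<subseteq> (\<Union>T\<in>\<T>. Z T) \<union> (\<Union>T\<in>\<T>. frontier T)"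
  proof
    fix x assume x: "x \<in> {x \<in> S. g x \<noteq> grad v x}"
    then obtain T where "T \<in> \<T>" "x \<in> T" using \<T>(3) by blast
    then show "x \<in> (\<Union>T\<in>\<T>. Z T) \<union> (\<Union>T\<in>\<T>. frontier T)"
      using x closure_subset[of T] by (cases "x \<in> interior T") (auto simp: Z_def frontier_def)
  qed
  ultimately have "negligible {x \<in> S. g x \<noteq> grad v x}" by (rule negligible_subset)
  then have "AE x in lebesgue. x \<notin> {x \<in> S. g x \<noteq> grad v x}"
    using AE_not_in negligible_iff_null_sets by blast
  then have "AE x in lebesgue. x \<in> S \<longrightarrow> g x = grad v x" by eventually_elim auto
  then show ?thesis using AE_restrict_space_iff[of S lebesgue] Sm by simp
qed

text \<open>The inequalities of Poincare and Korn survive the limit, because all the norms in them are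
continuous in \<open>H\<^sup>1\<close>; the limit \<open>g\<close> of the gradients is the pointwise gradient almost everywhere.\<close>

lemma Poincare_and_Korn_piecewise_smooth:
  fixes v :: "real^2 \<Rightarrow> real^2"
  assumes S: "open S" "S \<subseteq> cball 0 R" "0 \<le> R" and v: "v \<in> H1_0 S"
    and \<T>: "finite \<T>" "\<And>T. T \<in> \<T> \<Longrightarrow> convex T" "S \<subseteq> \<Union>\<T>"
    and w: "\<And>T. T \<in> \<T> \<Longrightarrow> C_k 2 (w T)" "\<And>T x. T \<in> \<T> \<Longrightarrow> x \<in> T \<Longrightarrow> v x = w T x"
  obtains g where "g \<in> L2_space S" "AE x in lebesgue_on S. g x = grad v x"
    "L2_norm S v \<le> 2 * R * L2_norm S g" "L2_norm S g \<le> sqrt 2 * L2_norm S (strain v)"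
proof -
  have bS: "bounded S" using S(2) bounded_cball bounded_subset by blast
  obtain g \<phi> where g: "v \<in> L2_space S" "g \<in> L2_space S" "\<And>n. \<phi> n \<in> test_functions S"
    "(\<lambda>n. L2_norm S (\<lambda>x. \<phi> n x - v x)) \<longlonglongrightarrow> 0" "(\<lambda>n. L2_norm S (\<lambda>x. grad (\<phi> n) x - g x)) \<longlonglongrightarrow> 0"
    using v unfolding H1_0_def by blast
  have C\<phi>: "C_k k (\<phi> n)" for k n using g(3)[of n] by (simp add: test_functions_def)
  define K where "K n = closure {x. \<phi> n x \<noteq> 0}" for n
  have K: "compact (K n)" "K n \<subseteq> S" "x \<notin> K n \<Longrightarrow> \<phi> n x = 0" for n x
    using g(3)[of n] closure_subset[of "{x. \<phi> n x \<noteq> 0}"] by (auto simp: test_functions_def K_def)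
  note L2 = continuous_in_L2_space[OF S(1) bS]
  have \<phi>2: "\<phi> n \<in> L2_space S" for n using C_k_imp_continuous[OF C\<phi>] by (rule L2)
  have g\<phi>2: "grad (\<phi> n) \<in> L2_space S" for n using continuous_on_grad[OF C\<phi>] by (rule L2)
  have symg: "(\<lambda>x. sym_part (g x)) \<in> L2_space S" using L2_space_linear[OF g(2) bounded_linear_sym] .
  have lim_v: "(\<lambda>n. L2_norm S (\<phi> n)) \<longlonglongrightarrow> L2_norm S v"
    using L2_norm_tendsto[OF \<phi>2 g(1,4)] .
  have lim_g: "(\<lambda>n. L2_norm S (grad (\<phi> n))) \<longlonglongrightarrow> L2_norm S g"
    using L2_norm_tendsto[OF g\<phi>2 g(2,5)] .
  have lim_s: "(\<lambda>n. L2_norm S (\<lambda>x. sym_part (grad (\<phi> n) x))) \<longlonglongrightarrow> L2_norm S (\<lambda>x. sym_part (g x))"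
    using L2_norm_tendsto[OF L2_space_linear[OF g\<phi>2 bounded_linear_sym] symg
        L2_norm_linear_tendsto[OF g\<phi>2 g(2) bounded_linear_sym g(5)]] .
  have Poincare: "L2_norm S v \<le> 2 * R * L2_norm S g"
  proof (rule LIMSEQ_le[OF lim_v tendsto_mult_left[OF lim_g]], intro exI allI impI)
    show "L2_norm S (\<phi> n) \<le> 2 * R * L2_norm S (grad (\<phi> n))" for n
      using Poincare_test_function[OF S C\<phi> K(1,2)] K(3) by blast
  qed
  have Korn: "L2_norm S g \<le> sqrt 2 * L2_norm S (\<lambda>x. sym_part (g x))"
  proof (rule LIMSEQ_le[OF lim_g tendsto_mult_left[OF lim_s]], intro exI allI impI)
    show "L2_norm S (grad (\<phi> n)) \<le> sqrt 2 * L2_norm S (\<lambda>x. sym_part (grad (\<phi> n) x))" for n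
      using Korn_test_function[OF S(1) bS C\<phi> K(1,2)] K(3) by blast
  qed
  have gv: "AE x in lebesgue_on S. g x = grad v x"
    by (rule H1_limit_gradient_AE[OF S(1) bS g(1,2) C\<phi> g(4,5) \<T> w])
  then have "AE x in lebesgue_on S. sym_part (g x) = strain v x"
    by eventually_elim (simp add: strain_eq_sym)
  then have strain: "L2_norm S (\<lambda>x. sym_part (g x)) = L2_norm S (strain v)"
    using L2_norm_cong_AE[OF _ L2_spaceD(1)[OF symg]] S(1) by simp
  show ?thesis
    using that[OF g(2) gv Poincare] Korn strain by simp
qed

section \<open>Second derivatives in terms of derivatives of the strain\<close>

lemma differentiable_vec:
  fixes f :: "real^2 \<Rightarrow> 'b::euclidean_space^2"
  assumes "\<And>j. (\<lambda>x. f x $ j) differentiable (at x)"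
  shows "f differentiable (at x)"
proof (subst differentiable_componentwise_within, intro ballI)
  fix i :: "'b^2" assume "i \<in> Basis"
  then obtain j u where i: "i = axis j u" by (auto simp: Basis_vec_def)
  obtain f' where "((\<lambda>x. f x $ j) has_derivative f') (at x)"
    using assms unfolding differentiable_def by blast
  from bounded_linear.has_derivative[OF bounded_linear_inner_left this, of u]
  show "(\<lambda>x. f x \<bullet> i) differentiable (at x)"
    unfolding i inner_axis differentiable_def by blast
qed

lemma C_k_vec:
  fixes f :: "real^2 \<Rightarrow> 'b::euclidean_space^2"
  shows "(\<And>j. C_k k (\<lambda>x. f x $ j)) \<Longrightarrow> C_k k f"
proof (induction k arbitrary: f)
  case 0
  then show ?case using continuous_on_vec_lambda[of UNIV "\<lambda>j x. f x $ j"] by simp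
next
  case (Suc k)
  have d: "f differentiable (at x)" for x
    using Suc.prems by (intro differentiable_vec) simp
  have "(\<lambda>x. partial_deriv i f x $ j) = partial_deriv i (\<lambda>x. f x $ j)" for i j
    using partial_deriv_linear[OF bounded_linear_vec_nth d] by auto
  then have "C_k k (partial_deriv i f)" for i
    using Suc.prems by (intro Suc.IH) simp
  with d show ?case by simp
qed

lemma C_k_grad: "C_k (Suc k) f \<Longrightarrow> C_k k (grad f)"
  by (rule C_k_vec) (simp add: grad_nth)

lemma C_k_strain: "C_k (Suc k) f \<Longrightarrow> C_k k (strain f)"
  using C_k_linear[OF bounded_linear_sym C_k_grad] by (simp add: strain_eq_sym[abs_def])

text \<open>The strain determines the Hessian by
\<open>\<partial>\<^sub>k \<partial>\<^sub>j w\<^sub>i = \<partial>\<^sub>k \<epsilon>\<^sub>i\<^sub>j + \<partial>\<^sub>j \<epsilon>\<^sub>i\<^sub>k - \<partial>\<^sub>i \<epsilon>\<^sub>j\<^sub>k\<close>. In two dimensions it is as short to compare the squared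
norms entry by entry, where the symmetry of second derivatives leaves six entries; this gives the
constant 2.\<close>

lemma norm_second_gradient_le:
  fixes w :: "real^2 \<Rightarrow> real^2"
  assumes w: "C_k 2 w"
  shows "norm (grad (grad w) x) \<le> 2 * norm (grad (strain w) x)"
proof -
  define M where "M k = partial_deriv k (grad w) x" for k
  have w2: "C_k (Suc (Suc 0)) w" using w by (simp only: numeral_2_eq_2)
  have dw: "w differentiable (at y)" and dg: "grad w differentiable (at y)" for y
    using w2 C_k_imp_differentiable[OF C_k_grad[OF w2]] by auto
  have M: "M k $ j $ i = partial_deriv k (partial_deriv j (\<lambda>x. w x $ i)) x" for k j i
  proof -
    have "M k $ j $ i = partial_deriv k (\<lambda>x. grad w x $ j $ i) x"
      unfolding M_def using partial_deriv_linear[OF bounded_linear_compose[OF bounded_linear_vec_nth bounded_linear_vec_nth] dg]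
      by (metis (no_types, lifting))
    then show ?thesis using grad_nth_nth[OF dw] by simp
  qed
  have comm: "M 2 $ 1 $ i = M 1 $ 2 $ i" for i
    unfolding M using C_k_linear[OF bounded_linear_vec_nth w] by (intro partial_deriv_commute)
  have strain: "grad (strain w) x $ k = sym_part (M k)" for k
    using partial_deriv_linear[OF bounded_linear_sym dg]
    by (simp add: grad_nth M_def strain_eq_sym[abs_def])
  have lhs: "(norm (grad (grad w) x))\<^sup>2 = (M 1 $ 1 $ 1)\<^sup>2 + (M 1 $ 1 $ 2)\<^sup>2 + 2 * (M 1 $ 2 $ 1)\<^sup>2
      + 2 * (M 1 $ 2 $ 2)\<^sup>2 + (M 2 $ 2 $ 1)\<^sup>2 + (M 2 $ 2 $ 2)\<^sup>2"
    unfolding power2_norm_eq_inner inner_vec_def sum_2 grad_nth M_def[symmetric]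
    by (simp add: comm power2_eq_square)
  have rhs: "(norm (grad (strain w) x))\<^sup>2 = (M 1 $ 1 $ 1)\<^sup>2 + (M 1 $ 1 $ 2 + M 1 $ 2 $ 1)\<^sup>2 / 2
      + (M 1 $ 2 $ 2)\<^sup>2 + (M 1 $ 2 $ 1)\<^sup>2 + (M 1 $ 2 $ 2 + M 2 $ 2 $ 1)\<^sup>2 / 2 + (M 2 $ 2 $ 2)\<^sup>2"
    unfolding power2_norm_eq_inner inner_vec_def sum_2 strain
    by (simp add: sym_part_def transpose_def comm power2_eq_square) (simp add: field_simps)
  (* An off-diagonal entry s is (s + t) - t, where s + t is twice a strain entry and t,
     by symmetry, a diagonal entry of the other matrix. *)
  have aux: "s\<^sup>2 \<le> 2 * (s + t)\<^sup>2 + 2 * t\<^sup>2" for s t :: real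
    using zero_le_power2[of "s + 2 * t"] by (simp add: power2_eq_square algebra_simps)
  have lin: "b \<le> 2 * s + 2 * c \<Longrightarrow> e \<le> 2 * t + 2 * d \<Longrightarrow> 0 \<le> a \<Longrightarrow> 0 \<le> f \<Longrightarrow>
      a + b + 2 * c + 2 * d + e + f \<le> 4 * (a + s / 2 + d + c + t / 2 + f)" for a b c d e f s t :: real
    by simp
  have "(norm (grad (grad w) x))\<^sup>2 \<le> 4 * (norm (grad (strain w) x))\<^sup>2"
    unfolding lhs rhs
    by (rule lin[OF aux _ zero_le_power2 zero_le_power2]) (subst add.commute, rule aux)
  then have "(norm (grad (grad w) x))\<^sup>2 \<le> (2 * norm (grad (strain w) x))\<^sup>2"
    by (simp add: power_mult_distrib)
  then show ?thesis by (rule power2_le_imp_le) simp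
qed

section \<open>The local spaces consist of polynomials\<close>

lemma polys_imp_real_polynomial_function: "p \<in> polys k \<Longrightarrow> real_polynomial_function p"
proof -
  assume "p \<in> polys k"
  then obtain c where p: "p = (\<lambda>x. \<Sum>i\<le>k. \<Sum>j\<le>k-i. c i j * (x$1)^i * (x$2)^j)"
    unfolding polys_def by blast
  have x: "real_polynomial_function (\<lambda>x::real^2. x $ i)" for i
    by (intro real_polynomial_function.intros(1) bounded_linear_vec_nth)
  show ?thesis
    unfolding p
    by (intro real_polynomial_function_sum finite_atMost real_polynomial_function.intros(2,4)
        real_polynomial_function_power x)
qed

lemma polynomial_function_vec:
  fixes v :: "real^2 \<Rightarrow> real^2"
  assumes "\<And>i. real_polynomial_function (\<lambda>x. v x $ i)"
  shows "polynomial_function v"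
  using assms by (auto simp: polynomial_function_iff_Basis_inner Basis_vec_def inner_axis)

lemma vec_polys_imp_polynomial_function: "v \<in> vec_polys k \<Longrightarrow> polynomial_function v"
  unfolding vec_polys_def by (auto intro: polynomial_function_vec polys_imp_real_polynomial_function)

lemma polys_1_iff: "p \<in> polys 1 \<longleftrightarrow> (\<exists>a b c. p = (\<lambda>x. a + b * x $ 1 + c * x $ 2))"
proof
  assume "p \<in> polys 1"
  then obtain d where "p = (\<lambda>x. \<Sum>i\<le>1. \<Sum>j\<le>1-i. d i j * (x$1)^i * (x$2)^j)"
    unfolding polys_def by blast
  then have "p = (\<lambda>x. d 0 0 + d 1 0 * x $ 1 + d 0 1 * x $ 2)"
    by (simp add: atMost_Suc add_ac)
  then show "\<exists>a b c. p = (\<lambda>x. a + b * x $ 1 + c * x $ 2)" by blast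
next
  assume "\<exists>a b c. p = (\<lambda>x. a + b * x $ 1 + c * x $ 2)"
  then obtain a b c where p: "p = (\<lambda>x. a + b * x $ 1 + c * x $ 2)" by blast
  define d where "d i j = (if i = 1 then b else if j = 1 then c else a)" for i j :: nat
  have "p = (\<lambda>x. \<Sum>i\<le>1. \<Sum>j\<le>1-i. d i j * (x$1)^i * (x$2)^j)"
    by (simp add: p d_def atMost_Suc add_ac)
  then show "p \<in> polys 1" unfolding polys_def by blast
qed

text \<open>The definite description in \<^const>\<open>barycentric\<close> is meaningful on a nondegenerate triangle: an affine
function takes prescribed values at three affinely independent points, and is determined by them
because their affine hull is the whole plane.\<close>

lemma barycentric_in_polys_1:
  assumes "2 simplex T" "z extreme_point_of T"
  shows "barycentric T z \<in> polys 1"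
proof -
  obtain C where C: "\<not> affine_dependent C" "card C = 3" "T = convex hull C"
    using assms(1) unfolding simplex_def by auto
  have ext: "y extreme_point_of T \<longleftrightarrow> y \<in> C" for y
    using extreme_point_of_convex_hull_affine_independent[OF C(1)] C(3) by blast
  have z: "z \<in> C" using assms(2) ext by blast
  have "C \<noteq> {z}" using C(2) by auto
  then obtain a where a: "a \<in> C" "a \<noteq> z" using z by blast
  define B where "B = (\<lambda>x. x - a) ` (C - {a})"
  have "independent B"
    using C(1) a(1) affine_dependent_iff_dependent[of a "C - {a}"]
    by (simp add: B_def insert_absorb image_def set_eq_iff Bex_def)
  obtain f :: "real^2 \<Rightarrow> real" where f: "linear f" "\<And>x. x \<in> B \<Longrightarrow> f x = (if x = z - a then 1 else 0)"
    using linear_independent_extend[OF \<open>independent B\<close>, of "\<lambda>x. if x = z - a then 1 else 0"] by blast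
  (* The vertex a is one at which the function must vanish. *)
  define l where "l x = f (x - a)" for x
  have l0: "l y = (if y = z then 1 else 0)" if "y \<in> C" for y
  proof (cases "y = a")
    case True
    then show ?thesis using a f(1) by (simp add: l_def linear_0)
  next
    case False
    then have "y - a \<in> B" using that by (auto simp: B_def)
    then show ?thesis using f(2) by (simp add: l_def)
  qed
  have lx: "l x = - f a + f (axis 1 1) * x $ 1 + f (axis 2 1) * x $ 2" for x
  proof -
    have "x = (x $ 1) *\<^sub>R axis 1 1 + (x $ 2) *\<^sub>R axis 2 1"
      by (simp add: vec_eq_iff forall_2 axis_def)
    then have "f x = f ((x $ 1) *\<^sub>R axis 1 1 + (x $ 2) *\<^sub>R axis 2 1)" by simp
    also have "\<dots> = x $ 1 * f (axis 1 1) + x $ 2 * f (axis 2 1)"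
      using f(1) by (simp add: linear_add linear_cmul)
    finally have "f x = x $ 1 * f (axis 1 1) + x $ 2 * f (axis 2 1)" .
    then show ?thesis using f(1) by (simp add: l_def linear_diff)
  qed
  then have l: "l \<in> polys 1" unfolding polys_1_iff by blast
  have "\<exists>!l. l \<in> polys 1 \<and> (\<forall>y. y extreme_point_of T \<longrightarrow> l y = (if y = z then 1 else 0))"
  proof (rule ex1I[of _ l])
    show "l \<in> polys 1 \<and> (\<forall>y. y extreme_point_of T \<longrightarrow> l y = (if y = z then 1 else 0))"
      using l l0 ext by blast
  next
    fix m assume m: "m \<in> polys 1 \<and> (\<forall>y. y extreme_point_of T \<longrightarrow> m y = (if y = z then 1 else 0))"
    have "affine {x. m x = l x}"
      unfolding affine_def
    proof (intro ballI allI impI, clarify)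
      fix x y :: "real^2" and u t :: real
      assume eq: "m x = l x" "m y = l y" and ut: "u + t = 1"
      have "h (u *\<^sub>R x + t *\<^sub>R y) = u * h x + t * h y" if h: "\<exists>a b c. h = (\<lambda>x. a + b * x $ 1 + c * x $ 2)" for h :: "real^2 \<Rightarrow> real"
      proof -
        obtain a b c where h: "h = (\<lambda>x. a + b * x $ 1 + c * x $ 2)" using h by blast
        have "a = u * a + t * a" using ut by (metis distrib_right mult_1)
        then show ?thesis by (simp add: h algebra_simps)
      qed
      then have "m (u *\<^sub>R x + t *\<^sub>R y) = u * m x + t * m y" "l (u *\<^sub>R x + t *\<^sub>R y) = u * l x + t * l y"
        using m l unfolding polys_1_iff by blast+
      then show "m (u *\<^sub>R x + t *\<^sub>R y) = l (u *\<^sub>R x + t *\<^sub>R y)" using eq by simp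
    qed
    moreover have "C \<subseteq> {x. m x = l x}" using m l0 ext by auto
    ultimately have "affine hull C \<subseteq> {x. m x = l x}" by (simp add: hull_minimal)
    moreover have "affine hull C = UNIV"
      using C by (intro affine_independent_span_eq) auto
    ultimately show "m = l" by auto
  qed
  from theI'[OF this] show ?thesis unfolding barycentric_def by blast
qed

lemma bubble_polynomial:
  assumes "2 simplex T"
  shows "real_polynomial_function (bubble T)"
proof -
  obtain C where C: "\<not> affine_dependent C" "T = convex hull C"
    using assms unfolding simplex_def by auto
  have "{z. z extreme_point_of T} = C"
    using extreme_point_of_convex_hull_affine_independent[OF C(1)] C(2) by blast
  then have "finite {z. z extreme_point_of T}" using aff_independent_finite[OF C(1)] by simp
  then show ?thesis
    unfolding bubble_def[abs_def]
    using barycentric_in_polys_1[OF assms] polys_imp_real_polynomial_function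
    by (intro real_polynomial_function_prod) auto
qed

lemma local_space_polynomial:
  assumes "2 simplex T" "W \<in> {W_first, W_second}" "w \<in> W T"
  shows "polynomial_function w"
proof -
  obtain p q k where w: "w = (\<lambda>x. p x + bubble T x *\<^sub>R q x)" "p \<in> vec_polys 2" "q \<in> vec_polys k"
    using assms(2,3) by (auto simp: W_first_def W_second_def P2_star_def P3_star_def)
  show ?thesis
    unfolding w(1) using w(2,3) bubble_polynomial[OF assms(1)]
    by (intro polynomial_function_add polynomial_function_mult vec_polys_imp_polynomial_function)
      (auto simp: real_polynomial_function_eq)
qed

section \<open>Norms over the triangulation\<close>

lemma negligible_closed_segment:
  fixes a b :: "real^2"
  shows "negligible (closed_segment a b)"
  by (simp add: negligible_convex_interior interior_closed_segment_ge2)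

text \<open>The closure of \<open>\<Omega>\<close> is covered by the triangles, but their interiors might a priori meet the
boundary of \<open>\<Omega>\<close>. As that boundary is a finite union of segments, this cannot matter for
integrals.\<close>

lemma negligible_frontier_polygon:
  assumes "polygon \<Omega>"
  shows "negligible (frontier \<Omega>)"
proof -
  obtain \<C> where C: "finite \<C>" "\<And>\<Gamma>. \<Gamma> \<in> \<C> \<Longrightarrow> polygonal_curve \<Gamma>" "frontier \<Omega> = \<Union>\<C>"
    using assms unfolding polygon_def by blast
  have "negligible \<Gamma>" if G: "\<Gamma> \<in> \<C>" for \<Gamma>
  proof -
    obtain E where "finite E" "\<Gamma> = (\<Union>(a, b)\<in>E. closed_segment a b)"
      using C(2)[OF G] unfolding polygonal_curve_def by blast
    then show ?thesis by (auto intro!: negligible_Union negligible_closed_segment)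
  qed
  then show ?thesis using C by (auto intro: negligible_Union)
qed

lemma broken_L2_norm_mono:
  assumes "\<And>T. T \<in> \<T> \<Longrightarrow> L2_norm (interior T) f \<le> c * L2_norm (interior T) h" "0 \<le> c"
  shows "broken_L2_norm \<T> f \<le> c * broken_L2_norm \<T> h"
proof -
  have "(\<Sum>T\<in>\<T>. (L2_norm (interior T) f)\<^sup>2) \<le> (\<Sum>T\<in>\<T>. c\<^sup>2 * (L2_norm (interior T) h)\<^sup>2)"
    using assms(1) by (intro sum_mono) (auto simp: power_mult_distrib[symmetric] L2_norm_nonneg intro!: power_mono)
  then have "broken_L2_norm \<T> f \<le> sqrt (c\<^sup>2 * (\<Sum>T\<in>\<T>. (L2_norm (interior T) h)\<^sup>2))"
    unfolding broken_L2_norm_def by (simp add: sum_distrib_left)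
  then show ?thesis using assms(2) by (simp add: broken_L2_norm_def real_sqrt_mult)
qed

text \<open>The intersection of two triangles is a face of each, and a proper face avoids the interior.\<close>

lemma interior_triangles_disjoint:
  assumes "triangulation \<T>" "T \<in> \<T>" "T' \<in> \<T>" "x \<in> interior T" "x \<in> interior T'"
  shows "T = T'"
proof -
  have "T \<inter> T' face_of T" "T' \<inter> T face_of T'"
    using assms unfolding triangulation_def by auto
  then have "T \<inter> T' = T" "T' \<inter> T = T'"
    using face_of_disjoint_interior assms(4,5) interior_subset by (metis IntI empty_iff subsetD)+
  then show ?thesis by blast
qed

text \<open>A point lies in the interior of at most one triangle, and then almost always in \<open>S\<close>, so the sum
of the integrals over the triangles is at most the integral over \<open>S\<close>.\<close>

lemma broken_L2_norm_le_L2_norm: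
  fixes f g :: "real^2 \<Rightarrow> 'b::euclidean_space"
  assumes \<T>: "triangulation \<T>" "\<Union>\<T> \<subseteq> closure S" and S: "open S" "negligible (frontier S)"
    and f: "\<And>T. T \<in> \<T> \<Longrightarrow> f \<in> L2_space (interior T)" and g: "g \<in> L2_space S"
    and eq: "AE x in lebesgue_on S. g x = f x"
  shows "broken_L2_norm \<T> f \<le> L2_norm S g"
proof -
  have fin: "finite \<T>" using \<T>(1) by (simp add: triangulation_def)
  define F where "F T x = (if x \<in> interior T then (norm (f x))\<^sup>2 else 0)" for T x
  define G where "G x = (if x \<in> S then (norm (g x))\<^sup>2 else 0)" for x
  have iF: "integrable lebesgue (F T)" "(LINT x|lebesgue. F T x) = (L2_norm (interior T) f)\<^sup>2" if "T \<in> \<T>" for T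
    using L2_spaceD(2)[OF f[OF that]] Lebesgue_Measure.integrable_restrict_UNIV[of "interior T" "\<lambda>x. (norm (f x))\<^sup>2"]
      Lebesgue_Measure.integral_restrict_UNIV[of "interior T" "\<lambda>x. (norm (f x))\<^sup>2"]
    by (simp_all add: F_def[abs_def] L2_norm_square)
  have iG: "integrable lebesgue G" "(LINT x|lebesgue. G x) = (L2_norm S g)\<^sup>2"
    using L2_spaceD(2)[OF g] Lebesgue_Measure.integrable_restrict_UNIV[of S "\<lambda>x. (norm (g x))\<^sup>2"] S(1)
      Lebesgue_Measure.integral_restrict_UNIV[of S "\<lambda>x. (norm (g x))\<^sup>2"]
    by (simp_all add: G_def[abs_def] L2_norm_square)
  have "AE x in lebesgue. x \<in> S \<longrightarrow> g x = f x"
    using eq AE_restrict_space_iff[of S lebesgue] S(1) by simp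
  moreover have "AE x in lebesgue. x \<notin> frontier S"
    using S(2) AE_not_in negligible_iff_null_sets by blast
  ultimately have le: "AE x in lebesgue. (\<Sum>T\<in>\<T>. F T x) \<le> G x"
  proof eventually_elim
    case (elim x)
    show ?case
    proof (cases "\<exists>T\<in>\<T>. x \<in> interior T")
      case True
      then obtain T where T: "T \<in> \<T>" "x \<in> interior T" by blast
      then have "x \<in> closure S" using \<T>(2) interior_subset[of T] by blast
      then have "x \<in> S" using elim(2) S(1) by (simp add: frontier_def interior_open)
      have "F T' x = 0" if "T' \<in> \<T> - {T}" for T'
        using interior_triangles_disjoint[OF \<T>(1) T(1), of T' x] T(2) that by (auto simp: F_def)
      then have "(\<Sum>T\<in>\<T>. F T x) = F T x" using fin T(1) by (simp add: sum.remove)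
      then show ?thesis using elim(1) \<open>x \<in> S\<close> T(2) by (simp add: F_def G_def)
    next
      case False
      then have "(\<Sum>T\<in>\<T>. F T x) = 0" by (intro sum.neutral) (auto simp: F_def)
      then show ?thesis by (simp add: G_def)
    qed
  qed
  have "(\<Sum>T\<in>\<T>. (L2_norm (interior T) f)\<^sup>2) = (LINT x|lebesgue. (\<Sum>T\<in>\<T>. F T x))"
    using iF by (subst Bochner_Integration.integral_sum) auto
  also have "\<dots> \<le> (L2_norm S g)\<^sup>2"
    unfolding iG(2)[symmetric] using iF(1) iG(1) le
    by (intro integral_mono_AE Bochner_Integration.integrable_sum) auto
  finally show ?thesis
    unfolding broken_L2_norm_def by (simp add: real_le_lsqrt L2_norm_nonneg)
qed

section \<open>The discrete Korn inequality\<close>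

theorem lemma5:
  fixes \<Omega> :: "(real^2) set" and \<sigma> :: real
    and W :: "(real^2) set \<Rightarrow> (real^2 \<Rightarrow> real^2) set"
  assumes "polygon \<Omega>" and "bounded \<Omega>"
    and "W \<in> {W_first, W_second}"
  shows "\<exists>C::real. \<forall>\<T>. triangulates \<T> \<Omega> \<and> shape_regular \<sigma> \<T> \<longrightarrow>
    (\<forall>v \<in> V_h W \<Omega> \<T>. H2_h_norm \<Omega> \<T> v \<le>
       C * (broken_L2_norm \<T> (grad (strain v)) + L2_norm \<Omega> (strain v)))"
proof -
  have \<Omega>: "open \<Omega>" using assms(1) by (simp add: polygon_def)
  obtain R0 where "\<And>x. x \<in> \<Omega> \<Longrightarrow> norm x \<le> R0"
    using assms(2) by (auto simp: bounded_iff)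
  then have R: "\<Omega> \<subseteq> cball 0 (max R0 0)" by force
  define R where "R = max R0 0"
  have R: "\<Omega> \<subseteq> cball 0 R" "0 \<le> R" using R by (simp_all add: R_def)
  show ?thesis
  proof (intro exI[of _ "2 * R * sqrt 2 + sqrt 2 + 2"] allI impI ballI)
    fix \<T> v
    assume \<T>: "triangulates \<T> \<Omega> \<and> shape_regular \<sigma> \<T>" and v: "v \<in> V_h W \<Omega> \<T>"
    have tri: "triangulation \<T>" "\<And>T. T \<in> \<T> \<Longrightarrow> 2 simplex T" "\<Union>\<T> = closure \<Omega>"
      using \<T> by (auto simp: triangulates_def)
    have v0: "v \<in> H1_0 \<Omega>" using v by (simp add: V_h_def)
    obtain w where w: "\<And>T. T \<in> \<T> \<Longrightarrow> w T \<in> W T" "\<And>T x. T \<in> \<T> \<Longrightarrow> x \<in> T \<Longrightarrow> v x = w T x"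
    proof -
      have "\<exists>w. \<forall>T\<in>\<T>. w T \<in> W T \<and> (\<forall>x\<in>T. v x = w T x)"
        using v unfolding V_h_def mem_Collect_eq by (elim conjE exE) (rule exI, assumption)
      then show ?thesis using that by blast
    qed
    have Cw: "C_k k (w T)" if "T \<in> \<T>" for k T
      using local_space_polynomial[OF tri(2)[OF that] assms(3) w(1)[OF that]] polynomial_function_imp_C_k by blast
    have conv: "convex T" "bounded (interior T)" if "T \<in> \<T>" for T
      using tri(2)[OF that] convex_simplex compact_simplex compact_imp_bounded bounded_interior by blast+
    have cover: "finite \<T>" "\<Omega> \<subseteq> \<Union>\<T>"
      using tri(1,3) closure_subset by (simp_all add: triangulation_def)
    obtain g where g: "g \<in> L2_space \<Omega>" "AE x in lebesgue_on \<Omega>. g x = grad v x"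
        and Poincare: "L2_norm \<Omega> v \<le> 2 * R * L2_norm \<Omega> g"
        and Korn: "L2_norm \<Omega> g \<le> sqrt 2 * L2_norm \<Omega> (strain v)"
      using Poincare_and_Korn_piecewise_smooth[OF \<Omega> R v0 cover(1) conv(1) cover(2) Cw w(2)] .
    have gvT: "grad v x = grad (w T) x" if "T \<in> \<T>" "x \<in> interior T" for T x
      using w(2)[OF that(1)] interior_subset[of T] that(2) by (intro grad_cong_open[of "interior T"]) auto
    have int: "open (interior T)" "bounded (interior T)" if "T \<in> \<T>" for T
      using conv(2)[OF that] by auto
    have first: "broken_L2_norm \<T> (grad v) \<le> L2_norm \<Omega> g"
    proof (rule broken_L2_norm_le_L2_norm[OF tri(1) _ \<Omega> negligible_frontier_polygon[OF assms(1)] _ g])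
      show "\<Union>\<T> \<subseteq> closure \<Omega>" using tri(3) by simp
      fix T assume T: "T \<in> \<T>"
      show "grad v \<in> L2_space (interior T)"
        using continuous_in_L2_space[OF int[OF T] continuous_on_grad[OF Cw[OF T]]]
          L2_space_cong[of "interior T" "grad v" "grad (w T)"] gvT[OF T] by simp
    qed
    have second: "broken_L2_norm \<T> (grad (grad v)) \<le> 2 * broken_L2_norm \<T> (grad (strain v))"
    proof (rule broken_L2_norm_mono)
      fix T assume T: "T \<in> \<T>"
      have gg: "grad (grad v) x = grad (grad (w T)) x" if "x \<in> interior T" for x
        using grad_cong_open[OF open_interior that gvT[OF T]] .
      have gs: "grad (strain v) x = grad (strain (w T)) x" if "x \<in> interior T" for x
        using gvT[OF T] by (intro grad_cong_open[OF open_interior that]) (simp add: strain_eq_sym)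
      have "L2_norm (interior T) (grad (grad (w T))) \<le> 2 * L2_norm (interior T) (grad (strain (w T)))"
        using norm_second_gradient_le[OF Cw[OF T]]
        by (intro L2_norm_mono continuous_in_L2_space[OF int[OF T]] continuous_on_grad C_k_grad C_k_strain Cw[OF T]) auto
      then show "L2_norm (interior T) (grad (grad v)) \<le> 2 * L2_norm (interior T) (grad (strain v))"
        using L2_norm_cong[of "interior T", OF gg] L2_norm_cong[of "interior T", OF gs] by simp
    qed simp
    have E: "0 \<le> broken_L2_norm \<T> (grad (strain v))"
      by (simp add: broken_L2_norm_def sum_nonneg)
    have "L2_norm \<Omega> v \<le> 2 * R * (sqrt 2 * L2_norm \<Omega> (strain v))"
      using Poincare mult_left_mono[OF Korn, of "2 * R"] R(2) by simp
    moreover have "broken_L2_norm \<T> (grad v) \<le> sqrt 2 * L2_norm \<Omega> (strain v)"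
      using first Korn by simp
    moreover have "0 \<le> (2 * R * sqrt 2 + sqrt 2) * broken_L2_norm \<T> (grad (strain v))"
      using E R(2) by simp
    moreover have "0 \<le> L2_norm \<Omega> (strain v)" by (rule L2_norm_nonneg)
    ultimately show "H2_h_norm \<Omega> \<T> v \<le> (2 * R * sqrt 2 + sqrt 2 + 2) *
        (broken_L2_norm \<T> (grad (strain v)) + L2_norm \<Omega> (strain v))"
      using second unfolding H2_h_norm_def by (simp add: algebra_simps)
  qed
qed

end
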